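(* Let $[I]\in \mathrm{Hilb}^d\mathbb{A}^3$ be a monomial point, i.e. $I\subseteq S=k[x,y,z]$ is a monomial ideal with $\dim_k(S/I)=d$. Then $$\dim_k T_{\mathrm{ppn}}(I)=\dim_k T_{\mathrm{nnp}}(I)+d,$$ $$\dim_k T_{\mathrm{pnp}}(I)=\dim_k T_{\mathrm{npn}}(I)+d,$$ $$\dim_k T_{\mathrm{npp}}(I)=\dim_k T_{\mathrm{pnn}}(I)+d.$$
   Context: $k$ is an infinite field and $S=k[x,y,z]$. $\mathrm{Hilb}^d\mathbb{A}^3$ is the Hilbert scheme of $d$ points in $\mathbb{A}^3=\mathrm{Spec}\,S$; $[I]$ denotes the $k$-point corresponding to an ideal $I\subseteq S$ with $\dim_k(S/I)=d$. Its tangent space at $[I]$ is $T(I)=\mathrm{Hom}_S(I,S/I)$. For $I$ monomial, $T(I)$ is $\mathbb{Z}^3$-graded: $|T(I)|_\alpha$ denotes the component of degree $\alpha\in\mathbb{Z}^3$, i.e. the $S$-linear maps $I\to S/I$ sending each monomial $\mathbf{x}^\beta\in I$ into the degree $\alpha+\beta$ component of $S/I$. For a non-constant triple $\mathfrak{s}=(\mathfrak s_1,\mathfrak s_2,\mathfrak s_3)$ of letters from $\{\mathrm{p},\mathrm{n}\}$ (p = "positive or 0", n = "negative") put $$T_{\mathfrak{s}}(I)=\bigoplus_{\alpha} |T(I)|_\alpha,$$ the sum over all $\alpha\in\mathbb{Z}^3$ with $\alpha_i\ge 0$ whenever $\mathfrak{s}_i=\mathrm{p}$ and $\alpha_i<0$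 whenever $\mathfrak{s}_i=\mathrm{n}$. For example, $T_{\mathrm{ppn}}(I)$ collects the degrees with $\alpha_1\ge0,\alpha_2\ge0,\alpha_3<0$. *)

theory Defs
  imports
    "HOL-Library.Poly_Mapping"
    "HOL-Library.Product_Plus"
    "HOL-Library.Extended_Nat"
    "HOL-Algebra.QuotRing"
    "Jordan_Normal_Form.VS_Connect"
begin

section \<open>The polynomial ring in three variables\<close>

text \<open>
  \<open>k[x,y,z]\<close> is the monoid algebra of \<open>\<nat>\<^sup>3\<close>: finitely supported functions from
  exponent triples to coefficients, with the convolution product of \<^theory>\<open>HOL-Library.Poly_Mapping\<close>.
  The exponent triple \<open>(a, b, c)\<close> stands for \<open>x\<^sup>a y\<^sup>b z\<^sup>c\<close>.
\<close>

type_synonym expo = "nat \<times> nat \<times> nat"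
type_synonym degree3 = "int \<times> int \<times> int"
type_synonym 'k poly3 = "expo \<Rightarrow>\<^sub>0 'k"

abbreviation base_field :: "'k::field ring" where
  "base_field \<equiv> class_ring"

abbreviation poly_ring :: "'k::field poly3 ring" where
  "poly_ring \<equiv> class_ring"

definition monom3 :: "expo \<Rightarrow> 'k::field poly3" where
  "monom3 \<beta> = Poly_Mapping.single \<beta> 1"

definition const3 :: "'k::field \<Rightarrow> 'k poly3" where
  "const3 c = Poly_Mapping.single 0 c"

definition deg3 :: "expo \<Rightarrow> degree3" where
  "deg3 = (\<lambda>(a, b, c). (int a, int b, int c))"

definition monomial_ideal :: "'k::field poly3 set \<Rightarrow> bool" where
  "monomial_ideal I \<longleftrightarrow> (\<exists>B. I = Idl\<^bsub>poly_ring\<^esub> (monom3 ` B))"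


section \<open>\<open>I\<close>, \<open>S/I\<close> and \<open>Hom\<^sub>S(I, S/I)\<close>\<close>

text \<open>
  A \<open>module\<close> record extends a ring record; its \<open>mult\<close> and \<open>one\<close> fields play no role for modules
  and are left \<open>undefined\<close> below.
\<close>

definition ideal_module :: "'k::field poly3 set \<Rightarrow> ('k poly3, 'k poly3) module" where
  "ideal_module I =
    \<lparr>carrier = I, mult = undefined, one = undefined, zero = 0, add = (+), smult = (*)\<rparr>"

definition quotient_module :: "'k::field poly3 set \<Rightarrow> ('k poly3, 'k poly3 set) module" where
  "quotient_module I =
    \<lparr>carrier = carrier (poly_ring Quot I), mult = undefined, one = undefined,
     zero = \<zero>\<^bsub>poly_ring Quot I\<^esub>, add = add (poly_ring Quot I),
     smult = (\<lambda>s X. (I +>\<^bsub>poly_ring\<^esub> s) \<otimes>\<^bsub>poly_ring Quot I\<^esub> X)\<rparr>"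

definition restrict_scalars :: "('k::field poly3, 'm) module \<Rightarrow> ('k, 'm) module" where
  "restrict_scalars M =
    \<lparr>carrier = carrier M, mult = undefined, one = undefined, zero = \<zero>\<^bsub>M\<^esub>, add = add M,
     smult = (\<lambda>c v. const3 c \<odot>\<^bsub>M\<^esub> v)\<rparr>"

text \<open>
  A map \<open>I \<rightarrow> S/I\<close> is a total HOL function; intersecting with \<open>extensional I\<close> fixes its values
  outside \<open>I\<close>, so that each homomorphism is represented exactly once.
\<close>

definition tangent_module :: "'k::field poly3 set \<Rightarrow> ('k poly3, 'k poly3 \<Rightarrow> 'k poly3 set) module" where
  "tangent_module I =
    \<lparr>carrier = module_hom poly_ring (ideal_module I) (quotient_module I) \<inter> extensional I,
     mult = undefined, one = undefined,
     zero = (\<lambda>f\<in>I. \<zero>\<^bsub>quotient_module I\<^esub>),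
     add = (\<lambda>\<phi> \<psi>. \<lambda>f\<in>I. \<phi> f \<oplus>\<^bsub>quotient_module I\<^esub> \<psi> f),
     smult = (\<lambda>s \<phi>. \<lambda>f\<in>I. s \<odot>\<^bsub>quotient_module I\<^esub> \<phi> f)\<rparr>"

abbreviation quotient_space :: "'k::field poly3 set \<Rightarrow> ('k, 'k poly3 set) module" where
  "quotient_space I \<equiv> restrict_scalars (quotient_module I)"

abbreviation tangent_space :: "'k::field poly3 set \<Rightarrow> ('k, 'k poly3 \<Rightarrow> 'k poly3 set) module" where
  "tangent_space I \<equiv> restrict_scalars (tangent_module I)"


section \<open>The grading by \<open>\<int>\<^sup>3\<close>\<close>

text \<open>
  The degree \<open>\<gamma>\<close> component of \<open>S/I\<close> is the image of the degree \<open>\<gamma>\<close> component of \<open>S\<close>; it is zero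
  if \<open>\<gamma>\<close> has a negative entry, since then only \<open>p = 0\<close> qualifies.
\<close>

definition quotient_component :: "'k::field poly3 set \<Rightarrow> degree3 \<Rightarrow> 'k poly3 set set" where
  "quotient_component I \<gamma> =
    (\<lambda>p. I +>\<^bsub>poly_ring\<^esub> p) ` {p. \<forall>\<beta>\<in>Poly_Mapping.keys p. deg3 \<beta> = \<gamma>}"

definition tangent_component ::
    "'k::field poly3 set \<Rightarrow> degree3 \<Rightarrow> ('k poly3 \<Rightarrow> 'k poly3 set) set" where
  "tangent_component I \<alpha> =
    {\<phi> \<in> carrier (tangent_space I).
       \<forall>\<beta>. monom3 \<beta> \<in> I \<longrightarrow> \<phi> (monom3 \<beta>) \<in> quotient_component I (\<alpha> + deg3 \<beta>)}"

datatype letter = letter_p | letter_n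

fun has_letter :: "letter \<Rightarrow> int \<Rightarrow> bool" where
  "has_letter letter_p a \<longleftrightarrow> a \<ge> 0"
| "has_letter letter_n a \<longleftrightarrow> a < 0"

fun has_signature :: "letter \<times> letter \<times> letter \<Rightarrow> degree3 \<Rightarrow> bool" where
  "has_signature (s1, s2, s3) (a1, a2, a3) \<longleftrightarrow>
     has_letter s1 a1 \<and> has_letter s2 a2 \<and> has_letter s3 a3"

text \<open>
  Inside \<open>T(I)\<close> the direct sum of graded components is the internal one: the linear span of their union.
\<close>

definition tangent_signed ::
    "letter \<times> letter \<times> letter \<Rightarrow> 'k::field poly3 set \<Rightarrow> ('k, 'k poly3 \<Rightarrow> 'k poly3 set) module" where
  "tangent_signed s I =
    (tangent_space I)\<lparr>carrier := LinearCombinations.module.span base_field (tangent_space I)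
       (\<Union>\<alpha>\<in>{\<alpha>. has_signature s \<alpha>}. tangent_component I \<alpha>)\<rparr>"


section \<open>Dimension over \<open>k\<close>\<close>

text \<open>
  The library's \<open>vectorspace.dim\<close> is a natural number that is only meaningful for
  finite-dimensional spaces.
\<close>

definition vdim :: "('k::field, 'v) module \<Rightarrow> enat" where
  "vdim V = (if vectorspace.fin_dim base_field V then enat (vectorspace.dim base_field V) else \<infinity>)"

end

theory Submission
  imports Defs
begin

text \<open>
  Let \<open>D\<close> be the finite set of exponents outside \<open>I\<close> and \<open>S\<close> the set of degrees of a signature. A map
  \<open>\<phi>\<close> in the signed part of \<open>T(I)\<close> is the function \<open>f(b, c)\<close>, the coefficient of \<open>x\<^sup>c\<close> in \<open>\<phi>(x\<^sup>b)\<close>, for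
  \<open>b \<notin> D\<close> and \<open>c \<in> D\<close>. Extending \<open>f\<close> arbitrarily to \<open>b \<in> D\<close> adds one dimension for each pair in
  \<open>D \<times> D\<close> with \<open>c - b \<in> S\<close>, and the failure of the extension to commute with the three variables is a
  1-cocycle on \<open>D \<times> D\<close>. If the degrees in \<open>S\<close> are negative along some axis, every cocycle arises
  from exactly one extension.

  The opposite signature has the degrees \<open>(-1, -1, -1) - a\<close> for \<open>a \<in> S\<close>. The cocycle conditions for \<open>S\<close>
  are indexed by the arguments of the cocycles for the opposite signature, and the two systems of
  equations are transposes of each other. Hence they have equal rank, the difference of the two
  dimensions is a difference of cardinalities of subsets of \<open>D \<times> D\<close>, and
  counting pairs by \<open>c - b\<close> gives \<open>card D\<close>.
\<close>

section \<open>Dimensions of spaces of functions\<close>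

text \<open>Behind the cocycles stands Ext. Write R for k[x,y,z]. Functions on \<open>D\<close> x
  \<open>D\<close> are the k-linear endomorphisms of R/I, \<open>diff i\<close> is the commutator
  with multiplication by the variable of axis \<open>i\<close>, and the three commutators form the
  Koszul complex that computes Ext_R(R/I, R/I). Every map R -> R/I vanishes on I, so T(I) = Hom_R(I,
  R/I) is Ext^1. Under the trace pairing the Koszul complex is self-dual up to a twist by the degree
  of xyz, so Ext^1 in the opposite degrees is dual to Ext^2, and the number \<open>d\<close> is an
  Euler characteristic up to sign. Ext^0 consists of the multiplications by elements of R/I, whose
  degrees have no negative entry; a negative axis makes it vanish. A signature and its opposite both
  have such an axis only if the signature is not constant. The obstacle is that a homomorphism lives
  on the infinite set \<open>E\<close> of exponents of I, while transposing a matrix needs finite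
  index sets. Passing to the extensions in \<open>Z\<close> and to their failure to commute moves
  everything to \<open>D\<close> x \<open>D\<close>.\<close>

definition lin_subspace :: "('i \<Rightarrow> 'k::field) set \<Rightarrow> bool" where
  "lin_subspace W \<longleftrightarrow> (\<lambda>_. 0) \<in> W \<and> (\<forall>f\<in>W. \<forall>g\<in>W. (\<lambda>x. f x + g x) \<in> W) \<and>
     (\<forall>c. \<forall>f\<in>W. (\<lambda>x. c * f x) \<in> W)"

text \<open>Restriction to the finite set \<open>Q\<close> is an isomorphism from \<open>W\<close> onto all functions on \<open>Q\<close>, so the
  dimension of \<open>W\<close> is \<open>card Q\<close>.\<close>
definition free_coords :: "('i \<Rightarrow> 'k::field) set \<Rightarrow> 'i set \<Rightarrow> bool" where
  "free_coords W Q \<longleftrightarrow> lin_subspace W \<and> finite Q \<and> (\<forall>h. \<exists>!f. f \<in> W \<and> (\<forall>q\<in>Q. f q = h q))"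

lemma lin_subspace_zero: "lin_subspace W \<Longrightarrow> (\<lambda>_. 0) \<in> W"
  and lin_subspace_add: "lin_subspace W \<Longrightarrow> f \<in> W \<Longrightarrow> g \<in> W \<Longrightarrow> (\<lambda>x. f x + g x) \<in> W"
  and lin_subspace_smult: "lin_subspace W \<Longrightarrow> f \<in> W \<Longrightarrow> (\<lambda>x. c * f x) \<in> W"
  by (simp_all add: lin_subspace_def)

lemma lin_subspace_diff:
  assumes "lin_subspace W" "f \<in> W" "g \<in> W"
  shows "(\<lambda>x. f x - g x) \<in> W"
  using lin_subspace_add[OF assms(1,2) lin_subspace_smult[OF assms(1,3), of "-1"]] by simp

lemma lin_subspace_sum:
  assumes "lin_subspace W" "\<And>a. a \<in> A \<Longrightarrow> f a \<in> W"
  shows "(\<lambda>x. \<Sum>a\<in>A. c a * f a x) \<in> W"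
proof (cases "finite A")
  case True
  then show ?thesis using assms(2)
  proof (induction A rule: finite_induct)
    case empty
    then show ?case using assms(1) by (simp add: lin_subspace_zero)
  next
    case (insert a A)
    have "(\<lambda>x. c a * f a x + (\<Sum>a\<in>A. c a * f a x)) \<in> W"
      using insert assms(1) by (intro lin_subspace_add lin_subspace_smult) auto
    then show ?case using insert by simp
  qed
qed (simp add: assms(1) lin_subspace_zero)

text \<open>The combination of the unit functions with coefficients \<open>h q\<close> interpolates
  \<open>h\<close> on \<open>Q\<close>, and two interpolants differ by an element vanishing on
  \<open>Q\<close>.\<close>

lemma free_coordsI:
  assumes W: "lin_subspace W" and "finite Q"
    and unit: "\<And>q. q \<in> Q \<Longrightarrow> \<exists>u\<in>W. \<forall>r\<in>Q. u r = (if r = q then 1 else 0)"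
    and det: "\<And>f. f \<in> W \<Longrightarrow> (\<And>q. q \<in> Q \<Longrightarrow> f q = 0) \<Longrightarrow> f = (\<lambda>_. 0)"
  shows "free_coords W Q"
  unfolding free_coords_def
proof (intro conjI allI ex_ex1I)
  fix h :: "'a \<Rightarrow> 'b"
  obtain u where u: "\<And>q. q \<in> Q \<Longrightarrow> u q \<in> W"
    "\<And>q r. q \<in> Q \<Longrightarrow> r \<in> Q \<Longrightarrow> u q r = (if r = q then 1 else 0)"
    using unit by metis
  let ?f = "\<lambda>x. \<Sum>q\<in>Q. h q * u q x"
  have "?f q = h q" if "q \<in> Q" for q
  proof -
    have "?f q = (\<Sum>r\<in>Q. if q = r then h r else 0)"
      using that u(2) by (intro sum.cong) auto
    then show ?thesis using that \<open>finite Q\<close> by simp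
  qed
  moreover have "?f \<in> W" using lin_subspace_sum[OF W, of Q u h] u(1) by blast
  ultimately show "\<exists>f. f \<in> W \<and> (\<forall>q\<in>Q. f q = h q)" by blast
next
  fix h f g assume *: "f \<in> W \<and> (\<forall>q\<in>Q. f q = h q)" "g \<in> W \<and> (\<forall>q\<in>Q. g q = h q)"
  then have "(\<lambda>x. f x - g x) = (\<lambda>_. 0)"
    by (intro det lin_subspace_diff W) auto
  then show "f = g" by (metis eq_iff_diff_eq_0 ext)
qed (fact W, fact \<open>finite Q\<close>)

lemma free_coords_ex1: "free_coords W Q \<Longrightarrow> \<exists>!f. f \<in> W \<and> (\<forall>q\<in>Q. f q = h q)"
  by (simp add: free_coords_def)

lemma free_coords_unit:
  assumes "free_coords W Q" "q \<in> Q"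
  obtains u where "u \<in> W" "\<And>r. r \<in> Q \<Longrightarrow> u r = (if r = q then 1 else 0)"
proof -
  have "\<exists>u. u \<in> W \<and> (\<forall>r\<in>Q. u r = (if r = q then 1 else 0))"
    using assms(1) by (intro ex1_implies_ex free_coords_ex1)
  then obtain u where "u \<in> W" "\<forall>r\<in>Q. u r = (if r = q then 1 else 0)" by (elim exE conjE)
  then show thesis by (intro that[of u]) simp_all
qed

lemma free_coords_eqI:
  assumes "free_coords W Q" "f \<in> W" "g \<in> W" "\<And>q. q \<in> Q \<Longrightarrow> f q = g q"
  shows "f = g"
proof -
  have "\<exists>!u. u \<in> W \<and> (\<forall>q\<in>Q. u q = f q)"
    using assms(1) by (rule free_coords_ex1)
  then show ?thesis using assms(2-4) by (elim ex1E) metis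
qed

text \<open>A smallest determining subset of \<open>P\<close> is free: when a point \<open>q\<close>
  is dropped, some nonzero element of \<open>W\<close> vanishes at all remaining points, and its
  value at \<open>q\<close> can be scaled to 1.\<close>

lemma free_coords_exists:
  assumes W: "lin_subspace W" and "finite P"
    and det: "\<And>f. f \<in> W \<Longrightarrow> (\<And>q. q \<in> P \<Longrightarrow> f q = 0) \<Longrightarrow> f = (\<lambda>_. 0)"
  obtains Q where "Q \<subseteq> P" "free_coords W Q"
proof -
  define determines where
    "determines Q \<longleftrightarrow> (\<forall>f\<in>W. (\<forall>q\<in>Q. f q = 0) \<longrightarrow> f = (\<lambda>_. 0))" for Q
  have "P \<subseteq> P \<and> determines P" using det by (simp add: determines_def)
  from ex_has_least_nat[of "\<lambda>Q. Q \<subseteq> P \<and> determines Q", OF this, of card]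
  obtain Q where Q: "Q \<subseteq> P" "determines Q"
    and min: "\<And>R. R \<subseteq> P \<Longrightarrow> determines R \<Longrightarrow> card Q \<le> card R"
    by blast
  have fin: "finite Q" using Q(1) \<open>finite P\<close> finite_subset by blast
  have "free_coords W Q"
  proof (rule free_coordsI[OF W fin])
    fix q assume q: "q \<in> Q"
    then have "\<not> card Q \<le> card (Q - {q})" using fin card_Diff1_less[of Q q] by simp
    then have "\<not> determines (Q - {q})" using Q(1) min[of "Q - {q}"] by blast
    then obtain f where f: "f \<in> W" "\<forall>r\<in>Q - {q}. f r = 0" "f \<noteq> (\<lambda>_. 0)"
      unfolding determines_def by meson
    have "f q \<noteq> 0" using Q(2) f unfolding determines_def by (metis Diff_iff singletonD)
    moreover have "(\<lambda>x. inverse (f q) * f x) \<in> W" using W f(1) by (rule lin_subspace_smult)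
    ultimately show "\<exists>u\<in>W. \<forall>r\<in>Q. u r = (if r = q then 1 else 0)"
      using f(2) by (intro bexI[of _ "\<lambda>x. inverse (f q) * f x"]) simp_all
  next
    show "f \<in> W \<Longrightarrow> (\<And>q. q \<in> Q \<Longrightarrow> f q = 0) \<Longrightarrow> f = (\<lambda>_. 0)" for f
      using Q(2) by (simp add: determines_def)
  qed
  with Q(1) show thesis by (rule that)
qed

section \<open>Gaussian elimination and the equality of row and column rank\<close>

definition matrix_kernel :: "('a \<Rightarrow> 'b \<Rightarrow> 'k::field) \<Rightarrow> 'a set \<Rightarrow> 'b set \<Rightarrow> ('a \<Rightarrow> 'k) set" where
  "matrix_kernel M A B = {g. (\<forall>a. a \<notin> A \<longrightarrow> g a = 0) \<and> (\<forall>b\<in>B. (\<Sum>a\<in>A. M a b * g a) = 0)}"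

lemma lin_subspace_matrix_kernel: "lin_subspace (matrix_kernel M A B)"
proof -
  have "(\<Sum>a\<in>A. M a b * (c * g a)) = c * (\<Sum>a\<in>A. M a b * g a)" for b c g
    by (simp add: sum_distrib_left mult.left_commute)
  then show ?thesis
    by (simp add: lin_subspace_def matrix_kernel_def distrib_left sum.distrib)
qed

text \<open>One elimination step. The equation \<open>b0\<close> solves for the value at
  \<open>a0\<close>, and substitution into the other equations gives the Schur complement
  \<open>M'\<close>. Inserting that value and erasing it are mutually inverse and leave the
  coordinates in \<open>Q\<close> untouched.\<close>

lemma matrix_kernel_pivot:
  assumes "finite A" "finite B" "a0 \<in> A" "b0 \<in> B" and M: "M a0 b0 \<noteq> 0"
    and M': "M' = (\<lambda>a b. M a b - M a b0 * M a0 b / M a0 b0)"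
    and ker: "free_coords (matrix_kernel M' (A - {a0}) (B - {b0})) Q" and "a0 \<notin> Q"
  shows "free_coords (matrix_kernel M A B) Q"
proof -
  let ?A = "A - {a0}" and ?B = "B - {b0}"
  let ?p = "\<lambda>g. - (\<Sum>a\<in>?A. M a b0 * g a) / M a0 b0"
  have A: "(\<Sum>a\<in>A. M a b * g a) = M a0 b * g a0 + (\<Sum>a\<in>?A. M a b * g a)" for g b
    using assms(1,3) by (simp add: sum.remove)
  have b0: "(\<Sum>a\<in>A. M a b0 * g a) = 0 \<longleftrightarrow> g a0 = ?p g" for g
    unfolding A using M by (subst eq_divide_eq) (simp add: add_eq_0_iff2 mult.commute)
  have M'_sum: "(\<Sum>a\<in>?A. M' a b * g a) = (\<Sum>a\<in>?A. M a b * g a) + M a0 b * ?p g" for g b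
  proof -
    have "(\<Sum>a\<in>?A. M' a b * g a) = (\<Sum>a\<in>?A. M a b * g a - M a0 b / M a0 b0 * (M a b0 * g a))"
      by (intro sum.cong) (simp_all add: M' left_diff_distrib)
    also have "\<dots> = (\<Sum>a\<in>?A. M a b * g a) - M a0 b / M a0 b0 * (\<Sum>a\<in>?A. M a b0 * g a)"
      unfolding sum_subtractf sum_distrib_left ..
    finally show ?thesis by simp
  qed
  have eqs: "(\<forall>b\<in>B. (\<Sum>a\<in>A. M a b * g a) = 0) \<longleftrightarrow>
      g a0 = ?p g \<and> (\<forall>b\<in>?B. (\<Sum>a\<in>?A. M' a b * g a) = 0)" for g
  proof -
    have "(\<forall>b\<in>B. (\<Sum>a\<in>A. M a b * g a) = 0) \<longleftrightarrow>
      g a0 = ?p g \<and> (\<forall>b\<in>?B. (\<Sum>a\<in>A. M a b * g a) = 0)"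
      using b0 \<open>b0 \<in> B\<close> by blast
    also have "\<dots> \<longleftrightarrow> g a0 = ?p g \<and> (\<forall>b\<in>?B. (\<Sum>a\<in>?A. M' a b * g a) = 0)"
      unfolding M'_sum A by (metis (no_types, lifting) add.commute)
    finally show ?thesis .
  qed
  have up: "g(a0 := ?p g) \<in> matrix_kernel M A B" if "g \<in> matrix_kernel M' ?A ?B" for g
  proof -
    have "(\<Sum>a\<in>?A. N a * (g(a0 := ?p g)) a) = (\<Sum>a\<in>?A. N a * g a)" for N :: "_ \<Rightarrow> 'c"
      by (intro sum.cong) auto
    then show ?thesis using that \<open>a0 \<in> A\<close>
      unfolding matrix_kernel_def mem_Collect_eq eqs by auto
  qed
  have down: "g(a0 := 0) \<in> matrix_kernel M' ?A ?B" and pg: "g a0 = ?p (g(a0 := 0))"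
    if "g \<in> matrix_kernel M A B" for g
  proof -
    have *: "(\<Sum>a\<in>?A. N a * (g(a0 := 0)) a) = (\<Sum>a\<in>?A. N a * g a)" for N :: "_ \<Rightarrow> 'c"
      by (intro sum.cong) auto
    show "g(a0 := 0) \<in> matrix_kernel M' ?A ?B" "g a0 = ?p (g(a0 := 0))"
      using that \<open>a0 \<in> A\<close> unfolding matrix_kernel_def mem_Collect_eq eqs * by auto
  qed
  show ?thesis
  proof (rule free_coordsI[OF lin_subspace_matrix_kernel])
    show "finite Q" using ker by (simp add: free_coords_def)
    fix q assume "q \<in> Q"
    then obtain u where "u \<in> matrix_kernel M' ?A ?B" "\<And>r. r \<in> Q \<Longrightarrow> u r = (if r = q then 1 else 0)"
      using free_coords_unit[OF ker] by metis
    then show "\<exists>u\<in>matrix_kernel M A B. \<forall>r\<in>Q. u r = (if r = q then 1 else 0)"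
      using up[of u] \<open>a0 \<notin> Q\<close> by (intro bexI[of _ "u(a0 := ?p u)"]) auto
  next
    fix f assume f: "f \<in> matrix_kernel M A B" "\<And>q. q \<in> Q \<Longrightarrow> f q = 0"
    have "f(a0 := 0) = (\<lambda>_. 0)"
      using ker down[OF f(1)] lin_subspace_zero[OF lin_subspace_matrix_kernel]
      by (rule free_coords_eqI) (auto simp: f(2))
    moreover from this have "f a0 = 0" using pg[OF f(1)] by simp
    ultimately show "f = (\<lambda>_. 0)" by (metis fun_upd_triv)
  qed
qed

lemma free_coords_matrix_kernel_zero:
  assumes "finite A" "\<And>a b. a \<in> A \<Longrightarrow> b \<in> B \<Longrightarrow> M a b = 0"
  shows "free_coords (matrix_kernel M A B) A"
proof (rule free_coordsI[OF lin_subspace_matrix_kernel \<open>finite A\<close>])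
  fix q assume "q \<in> A"
  then show "\<exists>u\<in>matrix_kernel M A B. \<forall>r\<in>A. u r = (if r = q then 1 else 0)"
    using assms(2) by (intro bexI[of _ "\<lambda>r. if r = q then 1 else 0"])
      (auto simp: matrix_kernel_def intro!: sum.neutral)
qed (auto simp: matrix_kernel_def)

text \<open>The Schur complement of the transpose at the same pivot is the transpose of the Schur
  complement, so each pivot removes one coordinate from either kernel. \<open>R\<close> and
  \<open>C\<close> collect the two indices of the pivots; their common size is the rank.\<close>

lemma matrix_kernel_rank:
  assumes "finite A" "finite B"
  shows "\<exists>R C. R \<subseteq> A \<and> C \<subseteq> B \<and> card R = card C \<and>
    free_coords (matrix_kernel M A B) (A - R) \<and> free_coords (matrix_kernel (\<lambda>b a. M a b) B A) (B - C)"
  using assms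
proof (induction "card A" arbitrary: A B M rule: less_induct)
  case less
  show ?case
  proof (cases "\<exists>a\<in>A. \<exists>b\<in>B. M a b \<noteq> 0")
    case False
    then show ?thesis
      using free_coords_matrix_kernel_zero[of A B M] less.prems
        free_coords_matrix_kernel_zero[of B A "\<lambda>b a. M a b"]
      by (intro exI[of _ "{}"]) auto
  next
    case True
    then obtain a0 b0 where ab: "a0 \<in> A" "b0 \<in> B" "M a0 b0 \<noteq> 0" by blast
    define M' where "M' = (\<lambda>a b. M a b - M a b0 * M a0 b / M a0 b0)"
    have "card (A - {a0}) < card A" using less.prems ab by (intro psubset_card_mono) auto
    then obtain R C where RC: "R \<subseteq> A - {a0}" "C \<subseteq> B - {b0}" "card R = card C"
      "free_coords (matrix_kernel M' (A - {a0}) (B - {b0})) (A - {a0} - R)"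
      "free_coords (matrix_kernel (\<lambda>b a. M' a b) (B - {b0}) (A - {a0})) (B - {b0} - C)"
      using less.hyps[of "A - {a0}" "B - {b0}" M'] less.prems by blast
    have "free_coords (matrix_kernel M A B) (A - {a0} - R)"
      using less.prems ab M'_def RC(4) by (rule matrix_kernel_pivot) auto
    moreover have "free_coords (matrix_kernel (\<lambda>b a. M a b) B A) (B - {b0} - C)"
      using less.prems(2,1) ab(2,1,3) _ RC(5)
      by (rule matrix_kernel_pivot) (auto simp: M'_def mult.commute)
    moreover have "A - {a0} - R = A - insert a0 R" "B - {b0} - C = B - insert b0 C" by auto
    moreover have "card (insert a0 R) = card (insert b0 C)"
      using RC(1-3) less.prems by (metis Diff_iff card_insert_disjoint finite_Diff finite_subset insertI1 subsetD)
    ultimately show ?thesis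
      using RC(1,2) ab by (intro exI[of _ "insert a0 R"] exI[of _ "insert b0 C"]) auto
  qed
qed

text \<open>In the unit functions of \<open>W\<close>, a kernel vector of the matrix of
  \<open>L\<close> yields an element of \<open>W\<close> killed by \<open>L\<close>. The kernel is
  therefore zero, no coordinate in \<open>Q\<close> is free, and \<open>Q\<close> has the size of
  the pivot set \<open>C\<close> inside \<open>Q'\<close>.\<close>

lemma free_coords_card_le:
  assumes W: "free_coords W Q" and W': "free_coords W' Q'"
    and L: "\<And>f. f \<in> W \<Longrightarrow> L f \<in> W'"
    and L_add: "\<And>f g. f \<in> W \<Longrightarrow> g \<in> W \<Longrightarrow> L (\<lambda>x. f x + g x) = (\<lambda>x. L f x + L g x)"
    and L_smult: "\<And>f c. f \<in> W \<Longrightarrow> L (\<lambda>x. c * f x) = (\<lambda>x. c * L f x)"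
    and ker: "\<And>f. f \<in> W \<Longrightarrow> L f = (\<lambda>_. 0) \<Longrightarrow> f = (\<lambda>_. 0)"
  shows "card Q \<le> card Q'"
proof -
  have fin: "finite Q" "finite Q'" and sub: "lin_subspace W" "lin_subspace W'"
    using W W' by (simp_all add: free_coords_def)
  obtain u where u: "\<And>q. q \<in> Q \<Longrightarrow> u q \<in> W"
    "\<And>q r. q \<in> Q \<Longrightarrow> r \<in> Q \<Longrightarrow> u q r = (if r = q then 1 else 0)"
  proof -
    have "\<forall>q\<in>Q. \<exists>u. u \<in> W \<and> (\<forall>r\<in>Q. u r = (if r = q then 1 else 0))"
      using free_coords_unit[OF W] by metis
    then show thesis using that by metis
  qed
  have L0: "L (\<lambda>_. 0) = (\<lambda>_. 0)"
    using L_smult[of "\<lambda>_. 0" 0] sub by (simp add: lin_subspace_zero)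
  have L_sum: "L (\<lambda>x. \<Sum>q\<in>R. h q * u q x) = (\<lambda>x. \<Sum>q\<in>R. h q * L (u q) x)" if "R \<subseteq> Q" for R h
    using finite_subset[OF that fin(1)] that
  proof (induction R rule: finite_induct)
    case (insert q R)
    have "L (\<lambda>x. h q * u q x + (\<Sum>q\<in>R. h q * u q x)) =
        (\<lambda>x. L (\<lambda>x. h q * u q x) x + L (\<lambda>x. \<Sum>q\<in>R. h q * u q x) x)"
      using insert u sub by (intro L_add lin_subspace_smult lin_subspace_sum) auto
    then show ?case using insert u by (simp add: L_smult)
  qed (simp add: L0)
  define M where "M = (\<lambda>q. L (u q))"
  obtain R C where RC: "R \<subseteq> Q" "C \<subseteq> Q'" "card R = card C"
    "free_coords (matrix_kernel M Q Q') (Q - R)"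
    using matrix_kernel_rank[OF fin, of M] by blast
  have "g = (\<lambda>_. 0)" if "g \<in> matrix_kernel M Q Q'" for g
  proof -
    let ?f = "\<lambda>x. \<Sum>q\<in>Q. g q * u q x"
    have f: "?f \<in> W" using sub u by (intro lin_subspace_sum) auto
    have "L ?f = (\<lambda>_. 0)"
      using W' L[OF f] lin_subspace_zero[OF sub(2)]
    proof (rule free_coords_eqI)
      show "L ?f q = 0" if "q \<in> Q'" for q
        using \<open>g \<in> matrix_kernel M Q Q'\<close> that
        by (simp add: L_sum matrix_kernel_def M_def mult.commute)
    qed
    then have "?f = (\<lambda>_. 0)" by (rule ker[OF f])
    moreover have "?f r = g r" if "r \<in> Q" for r
    proof -
      have "?f r = (\<Sum>q\<in>Q. if r = q then g q else 0)"
        using that u(2) by (intro sum.cong) auto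
      then show ?thesis using that fin by simp
    qed
    ultimately have "g r = 0" if "r \<in> Q" for r using that by metis
    then show ?thesis using that by (auto simp: matrix_kernel_def)
  qed
  moreover have "\<exists>g\<in>matrix_kernel M Q Q'. g q \<noteq> 0" if "q \<in> Q - R" for q
    using free_coords_unit[OF RC(4) that] that by (metis zero_neq_one)
  ultimately have "Q - R = {}" by blast
  then have "card Q = card C" using RC by (metis Diff_eq_empty_iff subset_antisym)
  then show ?thesis using RC(2) fin(2) by (simp add: card_mono)
qed

text \<open>The modules in question consist of cosets or of coset-valued maps. The linear bijection
  \<open>mk\<close> from coefficient functions lets spans and dimensions be computed on the side of
  functions.\<close>

locale function_model =
  fixes M :: "('k::field, 'v) module" and W :: "('i \<Rightarrow> 'k) set" and mk :: "('i \<Rightarrow> 'k) \<Rightarrow> 'v"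
  assumes W: "lin_subspace W"
    and carrier: "carrier M = mk ` W"
    and inj: "inj_on mk W"
    and zero: "\<zero>\<^bsub>M\<^esub> = mk (\<lambda>_. 0)"
    and add: "f \<in> W \<Longrightarrow> g \<in> W \<Longrightarrow> mk f \<oplus>\<^bsub>M\<^esub> mk g = mk (\<lambda>x. f x + g x)"
    and smult: "f \<in> W \<Longrightarrow> c \<odot>\<^bsub>M\<^esub> mk f = mk (\<lambda>x. c * f x)"
begin

lemmas W_closed = lin_subspace_zero[OF W] lin_subspace_add[OF W] lin_subspace_smult[OF W]

lemma neg: "f \<in> W \<Longrightarrow> mk f \<oplus>\<^bsub>M\<^esub> mk (\<lambda>x. - f x) = \<zero>\<^bsub>M\<^esub>"
  using W_closed(3)[of f "-1"] add[of f "\<lambda>x. - f x"] by (simp add: zero)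

sublocale vectorspace class_ring M
proof (rule vs_criteria, goal_cases)
  case 1
  show ?case by (rule class_field)
next
  case 4
  show ?case
    unfolding carrier using neg W_closed(3)[of _ "-1"] by fastforce
qed (auto simp: carrier zero add smult W_closed algebra_simps)

lemma submodule_image:
  assumes "lin_subspace U" "U \<subseteq> W"
  shows "LinearCombinations.submodule class_ring (mk ` U) M"
proof (rule LinearCombinations.submodule.intro[OF module.module_axioms])
  show "mk ` U \<subseteq> carrier M" using assms(2) carrier by blast
  show "\<zero>\<^bsub>M\<^esub> \<in> mk ` U" using lin_subspace_zero[OF assms(1)] zero by blast
  show "v \<oplus>\<^bsub>M\<^esub> w \<in> mk ` U" if "v \<in> mk ` U" "w \<in> mk ` U" for v w
    using that assms lin_subspace_add[OF assms(1)] add by (auto simp: subset_iff)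
  show "c \<odot>\<^bsub>M\<^esub> v \<in> mk ` U" if "v \<in> mk ` U" for c v
    using that assms lin_subspace_smult[OF assms(1)] smult by (auto simp: subset_iff)
qed

lemma lin_subspace_vimage:
  assumes "LinearCombinations.submodule class_ring N M"
  shows "lin_subspace {f \<in> W. mk f \<in> N}"
  unfolding lin_subspace_def
proof (intro conjI ballI allI)
  have N: "\<zero>\<^bsub>M\<^esub> \<in> N" "\<And>v w. v \<in> N \<Longrightarrow> w \<in> N \<Longrightarrow> v \<oplus>\<^bsub>M\<^esub> w \<in> N"
    "\<And>c v. v \<in> N \<Longrightarrow> c \<odot>\<^bsub>M\<^esub> v \<in> N"
    using assms by (auto simp: LinearCombinations.submodule_def)
  show "(\<lambda>_. 0) \<in> {f \<in> W. mk f \<in> N}" using N(1) zero W_closed(1) by simp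
  show "(\<lambda>x. f x + g x) \<in> {f \<in> W. mk f \<in> N}"
    if "f \<in> {f \<in> W. mk f \<in> N}" "g \<in> {f \<in> W. mk f \<in> N}" for f g
    using that N(2)[of "mk f" "mk g"] W_closed(2) by (simp add: add)
  show "(\<lambda>x. c * f x) \<in> {f \<in> W. mk f \<in> N}" if "f \<in> {f \<in> W. mk f \<in> N}" for f c
    using that N(3)[of "mk f" c] W_closed(3) by (simp add: smult)
qed

text \<open>The hypothesis \<open>least\<close> expresses without linear combinations that
  \<open>X\<close> generates \<open>U\<close>; it is applied to the preimage of the abstract span,
  which is a subspace of functions.\<close>

lemma span_image:
  assumes "X \<subseteq> U" "lin_subspace U" "U \<subseteq> W"
    and least: "\<And>V. lin_subspace V \<Longrightarrow> X \<subseteq> V \<Longrightarrow> U \<subseteq> V"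
  shows "span (mk ` X) = mk ` U"
proof
  show "span (mk ` X) \<subseteq> mk ` U"
    using assms(1-3) by (intro span_is_subset submodule_image) auto
  have X: "mk ` X \<subseteq> carrier M" using assms(1,3) carrier by blast
  have "U \<subseteq> {f \<in> W. mk f \<in> span (mk ` X)}"
    using in_own_span[OF X] assms(1,3)
    by (intro least lin_subspace_vimage span_is_submodule X) auto
  then show "mk ` U \<subseteq> span (mk ` X)" by blast
qed

text \<open>Finite generation in terms of subspaces of functions: this form can bound supports
  before any finite set of coordinates is known.\<close>

lemma fin_dim_generators:
  assumes fin_dim
  obtains F where "finite F" "F \<subseteq> W" "\<And>V. lin_subspace V \<Longrightarrow> F \<subseteq> V \<Longrightarrow> V \<subseteq> W \<Longrightarrow> W \<subseteq> V"
proof -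
  obtain A where A: "finite A" "A \<subseteq> carrier M" "span A = carrier M"
    using assms by (auto simp: fin_dim_def)
  obtain F where F: "F \<subseteq> W" "finite F" "A = mk ` F"
    using finite_subset_image[OF A(1) A(2)[unfolded carrier]] by auto
  show thesis
  proof (rule that[OF F(2,1)])
    fix V assume V: "lin_subspace V" "F \<subseteq> V" "V \<subseteq> W"
    have "mk ` W \<subseteq> mk ` V"
      using span_is_subset[OF _ submodule_image[OF V(1,3)], of A] V(2) F(3) A(3) carrier by auto
    then show "W \<subseteq> V" using V(3) inj_onD[OF inj] by (fastforce simp: image_subset_iff)
  qed
qed

lemma finsum_mk:
  assumes "finite Q" "\<And>q. q \<in> Q \<Longrightarrow> u q \<in> W"
  shows "(\<Oplus>\<^bsub>M\<^esub>q\<in>Q. c q \<odot>\<^bsub>M\<^esub> mk (u q)) = mk (\<lambda>x. \<Sum>q\<in>Q. c q * u q x)"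
  using assms
proof (induction Q rule: finite_induct)
  case (insert q Q)
  have "(\<Oplus>\<^bsub>M\<^esub>q\<in>insert q Q. c q \<odot>\<^bsub>M\<^esub> mk (u q)) =
      c q \<odot>\<^bsub>M\<^esub> mk (u q) \<oplus>\<^bsub>M\<^esub> (\<Oplus>\<^bsub>M\<^esub>q\<in>Q. c q \<odot>\<^bsub>M\<^esub> mk (u q))"
    using insert by (intro M.finsum_insert) (auto simp: carrier smult W_closed)
  then show ?case
    using insert by (simp add: smult add W_closed lin_subspace_sum[OF W])
qed (simp add: zero)

text \<open>The images of the unit functions at the points of \<open>Q\<close> form a basis, the
  coefficients of an element being its values on \<open>Q\<close>.\<close>

lemma vdim_eq_card:
  assumes Q: "free_coords W Q"
  shows "vdim M = enat (card Q)"
proof -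
  have fin: "finite Q" using Q by (simp add: free_coords_def)
  have "\<forall>q\<in>Q. \<exists>u. u \<in> W \<and> (\<forall>r\<in>Q. u r = (if r = q then 1 else 0))"
    using free_coords_unit[OF Q] by metis
  then obtain u where u: "\<And>q. q \<in> Q \<Longrightarrow> u q \<in> W"
    "\<And>q r. q \<in> Q \<Longrightarrow> r \<in> Q \<Longrightarrow> u q r = (if r = q then 1 else 0)"
    by metis
  define e where "e = (\<lambda>q. mk (u q))"
  have inj_e: "inj_on e Q"
  proof (rule inj_onI)
    fix q r assume "q \<in> Q" "r \<in> Q" "e q = e r"
    then have "u q r = u r r" using inj_onD[OF inj] u(1) by (metis e_def)
    then show "q = r" using \<open>q \<in> Q\<close> \<open>r \<in> Q\<close> u(2) by (metis zero_neq_one)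
  qed
  have e_carrier: "e ` Q \<subseteq> carrier M" using u(1) carrier by (auto simp: e_def)
  have lincomb: "lincomb a (e ` Q) = mk (\<lambda>x. \<Sum>q\<in>Q. a (e q) * u q x)" for a
    unfolding lincomb_def using inj_e e_carrier u(1)
    by (subst M.finsum_reindex) (auto simp: e_def finsum_mk[OF fin] carrier smult W_closed)
  have coord: "(\<Sum>q\<in>Q. c q * u q r) = c r" if "r \<in> Q" for c r
  proof -
    have "(\<Sum>q\<in>Q. c q * u q r) = (\<Sum>q\<in>Q. if r = q then c q else 0)"
      using that u(2) by (intro sum.cong) auto
    then show ?thesis using that fin by simp
  qed
  have "basis (e ` Q)"
    unfolding basis_criterion[OF finite_imageI[OF fin] e_carrier]
  proof (intro allI impI ex_ex1I)
    fix v assume "v \<in> carrier M"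
    then obtain f where f: "f \<in> W" "v = mk f" using carrier by auto
    let ?a = "restrict (\<lambda>w. f (the_inv_into Q e w)) (e ` Q)"
    have "(\<lambda>x. \<Sum>q\<in>Q. ?a (e q) * u q x) = f"
      using u(1) by (intro free_coords_eqI[OF Q] lin_subspace_sum[OF W] f(1))
        (auto simp: coord the_inv_into_f_f[OF inj_e])
    then show "\<exists>a. a \<in> e ` Q \<rightarrow>\<^sub>E carrier class_ring \<and> lincomb a (e ` Q) = v"
      using f(2) by (intro exI[of _ ?a]) (auto simp: lincomb)
  next
    fix v a b
    assume a: "a \<in> e ` Q \<rightarrow>\<^sub>E carrier class_ring \<and> lincomb a (e ` Q) = v"
      and b: "b \<in> e ` Q \<rightarrow>\<^sub>E carrier class_ring \<and> lincomb b (e ` Q) = v"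
    then have "mk (\<lambda>x. \<Sum>q\<in>Q. a (e q) * u q x) = mk (\<lambda>x. \<Sum>q\<in>Q. b (e q) * u q x)"
      by (simp add: lincomb)
    then have eq: "(\<lambda>x. \<Sum>q\<in>Q. a (e q) * u q x) = (\<lambda>x. \<Sum>q\<in>Q. b (e q) * u q x)"
      using u(1) by (intro inj_onD[OF inj] lin_subspace_sum[OF W]) auto
    have "a (e r) = b (e r)" if "r \<in> Q" for r
      using fun_cong[OF eq, of r] that by (simp add: coord)
    then show "a = b" using a b by (intro PiE_ext[of a "e ` Q" _ b]) auto
  qed
  then have "fin_dim" "dim = card (e ` Q)"
    using fin e_carrier dim_basis[of "e ` Q"] by (auto simp: fin_dim_def basis_def)
  then show ?thesis using inj_e by (simp add: vdim_def card_image)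
qed

end

section \<open>Cocycles on a finite staircase\<close>

datatype axis = X1 | X2 | X3

lemma UNIV_axis: "UNIV = {X1, X2, X3}"
  using axis.exhaust by auto

instance axis :: finite
  by standard (simp add: UNIV_axis)

fun next_axis :: "axis \<Rightarrow> axis" where
  "next_axis X1 = X2" | "next_axis X2 = X3" | "next_axis X3 = X1"

fun coord :: "axis \<Rightarrow> degree3 \<Rightarrow> int" where
  "coord X1 (x, y, z) = x" | "coord X2 (x, y, z) = y" | "coord X3 (x, y, z) = z"

fun shift :: "axis \<Rightarrow> int \<Rightarrow> degree3 \<Rightarrow> degree3" where
  "shift X1 t (x, y, z) = (x + t, y, z)"
| "shift X2 t (x, y, z) = (x, y + t, z)"
| "shift X3 t (x, y, z) = (x, y, z + t)"

lemma shift_shift [simp]: "shift i s (shift i t a) = shift i (t + s) a"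
  by (cases i; cases a) auto

lemma shift_commute: "shift i s (shift j t a) = shift j t (shift i s a)"
  by (cases i; cases j; cases a) auto

lemma shift_0 [simp]: "shift i 0 a = a"
  by (cases i; cases a) auto

lemma coord_shift: "coord j (shift i t a) = (if j = i then coord i a + t else coord j a)"
  by (cases i; cases j; cases a) auto

lemma shift_diff_left [simp]: "shift i t a - b = shift i t (a - b)"
  by (cases i; cases a; cases b) auto

lemma shift_diff_right [simp]: "a - shift i t b = shift i (- t) (a - b)"
  by (cases i; cases a; cases b) auto

lemma coord_diff: "coord i (a - b) = coord i a - coord i b"
  by (cases i; cases a; cases b) auto

text \<open>The map t -> -1 - t exchanges nonnegative and negative integers, hence the letters p and
  n, whereas t -> -t would leave 0 in place.\<close>

definition dual_degrees :: "degree3 set \<Rightarrow> degree3 set" where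
  "dual_degrees S = {a. (-1, -1, -1) - a \<in> S}"

text \<open>If \<open>f (b, c)\<close> is the coefficient of \<open>x\<^sup>c\<close> in \<open>\<phi>(x\<^sup>b)\<close>, then \<open>diff i f b c\<close> is that of
  \<open>x\<^sub>i \<phi>(x\<^sup>b) - \<phi>(x\<^sub>i x\<^sup>b)\<close>.\<close>
definition diff :: "axis \<Rightarrow> (degree3 \<times> degree3 \<Rightarrow> 'k::field) \<Rightarrow> degree3 \<Rightarrow> degree3 \<Rightarrow> 'k" where
  "diff i f b c = f (b, shift i (-1) c) - f (shift i 1 b, c)"

lemma diff_add: "diff i (\<lambda>p. f p + g p) b c = diff i f b c + diff i g b c"
  and diff_smult: "diff i (\<lambda>p. a * f p) b c = a * diff i f b c"
  and diff_zero: "diff i (\<lambda>p. 0) b c = 0"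
  by (simp_all add: diff_def algebra_simps)

lemma lin_subspace_support_relations:
  "lin_subspace {f :: 'a \<Rightarrow> 'k::field. (\<forall>p. f p \<noteq> 0 \<longrightarrow> P p) \<and> (\<forall>(p, q)\<in>R. f p = f q)}"
proof -
  have "P p" if "f p + g p \<noteq> 0" "\<forall>p. f p \<noteq> 0 \<longrightarrow> P p" "\<forall>p. g p \<noteq> 0 \<longrightarrow> P p" for f g :: "'a \<Rightarrow> 'k" and p
  proof -
    have "f p \<noteq> 0 \<or> g p \<noteq> 0" using that(1) by auto
    then show ?thesis using that(2,3) by blast
  qed
  then show ?thesis by (simp add: lin_subspace_def case_prod_unfold)
qed

declare split_paired_All [simp del] split_paired_Ex [simp del]

text \<open>A finite order ideal of the octant, placed in integer coordinates: degrees
  \<open>c - b\<close> have mixed signs, and shifts must be able to step out of the octant, where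
  the functions considered below vanish.\<close>

locale staircase =
  fixes D :: "degree3 set"
  assumes finite_D: "finite D"
    and D_nonneg: "c \<in> D \<Longrightarrow> 0 \<le> coord i c"
    and D_down: "c \<in> D \<Longrightarrow> 1 \<le> coord i c \<Longrightarrow> shift i (-1) c \<in> D"
begin

text \<open>With \<open>D\<close> the exponents outside an ideal and \<open>E\<close> those in it, \<open>T S\<close> is the part of \<open>T(I)\<close> in
  degrees \<open>S\<close>; \<open>Z S\<close> extends it by arbitrary values at \<open>b \<in> D\<close>, and \<open>K S\<close> are the cocycles.\<close>
definition E :: "degree3 set" where
  "E = {b. (\<forall>i. 0 \<le> coord i b) \<and> b \<notin> D}"

definition T :: "degree3 set \<Rightarrow> (degree3 \<times> degree3 \<Rightarrow> 'k::field) set" where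
  "T S = {f. (\<forall>b c. f (b, c) \<noteq> 0 \<longrightarrow> b \<in> E \<and> c \<in> D \<and> c - b \<in> S) \<and>
     (\<forall>i. \<forall>b\<in>E. \<forall>c\<in>D. f (shift i 1 b, c) = f (b, shift i (-1) c))}"

definition Z :: "degree3 set \<Rightarrow> (degree3 \<times> degree3 \<Rightarrow> 'k::field) set" where
  "Z S = {f. (\<forall>b c. f (b, c) \<noteq> 0 \<longrightarrow> b \<in> D \<union> E \<and> c \<in> D \<and> c - b \<in> S) \<and>
     (\<forall>i. \<forall>b\<in>E. \<forall>c\<in>D. f (shift i 1 b, c) = f (b, shift i (-1) c))}"

definition pairs :: "degree3 set \<Rightarrow> (degree3 \<times> degree3) set" where
  "pairs S = {(b, c). b \<in> D \<and> c \<in> D \<and> c - b \<in> S}"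

text \<open>The component of a differential along axis \<open>i\<close> has degree one higher along
  \<open>i\<close> than the function itself. The shift by -1 undoes this, so that \<open>S\<close>
  always refers to the degree of the original function.\<close>

definition arrows :: "degree3 set \<Rightarrow> (axis \<times> degree3 \<times> degree3) set" where
  "arrows S = {(i, b, c). b \<in> D \<and> c \<in> D \<and> shift i (-1) (c - b) \<in> S}"

definition K :: "degree3 set \<Rightarrow> (axis \<times> degree3 \<times> degree3 \<Rightarrow> 'k::field) set" where
  "K S = {g. (\<forall>p. p \<notin> arrows S \<longrightarrow> g p = 0) \<and>
     (\<forall>i j. \<forall>b\<in>D. \<forall>c\<in>D. diff i (\<lambda>p. g (j, p)) b c = diff j (\<lambda>p. g (i, p)) b c)}"

lemma E_nonneg: "b \<in> E \<Longrightarrow> 0 \<le> coord i b"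
  by (simp add: E_def)

lemma D_E_disjoint: "b \<in> D \<Longrightarrow> b \<notin> E"
  by (simp add: E_def)

lemma D_E_cases: "(\<And>i. 0 \<le> coord i b) \<Longrightarrow> b \<in> D \<or> b \<in> E"
  by (simp add: E_def)

lemma E_up: "b \<in> E \<Longrightarrow> shift i 1 b \<in> E"
  using D_down[of "shift i 1 b" i] by (auto simp: E_def coord_shift)

lemma lin_subspace_T: "lin_subspace (T S :: (_ \<Rightarrow> 'k::field) set)"
proof -
  have "(T S :: (_ \<Rightarrow> 'k) set) = {f. (\<forall>p. f p \<noteq> 0 \<longrightarrow> fst p \<in> E \<and> snd p \<in> D \<and> snd p - fst p \<in> S) \<and>
     (\<forall>(p, q)\<in>(\<lambda>(i, b, c). ((shift i 1 b, c), (b, shift i (-1) c))) ` (UNIV \<times> E \<times> D). f p = f q)}"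
    unfolding T_def by (intro Collect_cong conj_cong) (auto simp: split_paired_All)
  then show ?thesis by (simp only: lin_subspace_support_relations)
qed

lemma lin_subspace_Z: "lin_subspace (Z S :: (_ \<Rightarrow> 'k::field) set)"
proof -
  have "(Z S :: (_ \<Rightarrow> 'k) set) = {f. (\<forall>p. f p \<noteq> 0 \<longrightarrow> fst p \<in> D \<union> E \<and> snd p \<in> D \<and> snd p - fst p \<in> S) \<and>
     (\<forall>(p, q)\<in>(\<lambda>(i, b, c). ((shift i 1 b, c), (b, shift i (-1) c))) ` (UNIV \<times> E \<times> D). f p = f q)}"
    unfolding Z_def by (intro Collect_cong conj_cong) (auto simp: split_paired_All)
  then show ?thesis by (simp only: lin_subspace_support_relations)
qed

lemma T_subset_Z: "T S \<subseteq> Z S"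
  by (auto simp: T_def Z_def)

lemma finite_pairs: "finite (pairs S)"
  by (rule finite_subset[of _ "D \<times> D"]) (auto simp: pairs_def finite_D)

lemma finite_arrows: "finite (arrows S)"
  by (rule finite_subset[of _ "UNIV \<times> D \<times> D"]) (auto simp: arrows_def finite_D)

lemma T_support: "f \<in> T S \<Longrightarrow> f (b, c) \<noteq> 0 \<Longrightarrow> b \<in> E \<and> c \<in> D \<and> c - b \<in> S"
  and T_shift: "f \<in> T S \<Longrightarrow> b \<in> E \<Longrightarrow> c \<in> D \<Longrightarrow> f (shift i 1 b, c) = f (b, shift i (-1) c)"
  by (simp_all add: T_def)

lemma Z_support: "f \<in> Z S \<Longrightarrow> f (b, c) \<noteq> 0 \<Longrightarrow> b \<in> D \<union> E \<and> c \<in> D \<and> c - b \<in> S"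
  and Z_shift: "f \<in> Z S \<Longrightarrow> b \<in> E \<Longrightarrow> c \<in> D \<Longrightarrow> f (shift i 1 b, c) = f (b, shift i (-1) c)"
  by (simp_all add: Z_def)

lemma K_arrows: "g \<in> K S \<Longrightarrow> g p \<noteq> 0 \<Longrightarrow> p \<in> arrows S"
  by (auto simp: K_def)

lemma K_support:
  "g \<in> K S \<Longrightarrow> g (i, b, c) \<noteq> 0 \<Longrightarrow> b \<in> D \<and> c \<in> D \<and> shift i (-1) (c - b) \<in> S"
  using K_arrows[of g S "(i, b, c)"] by (simp add: arrows_def)

lemma K_cocycle: "g \<in> K S \<Longrightarrow> b \<in> D \<Longrightarrow> c \<in> D \<Longrightarrow>
    diff i (\<lambda>p. g (j, p)) b c = diff j (\<lambda>p. g (i, p)) b c"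
  by (simp add: K_def)

lemma D_bounded: obtains m where "\<And>c i. c \<in> D \<Longrightarrow> coord i c < m"
proof -
  have "finite ((\<lambda>(i, c). coord i c) ` (UNIV \<times> D))" using finite_D by simp
  then obtain m where m: "\<And>x. x \<in> (\<lambda>(i, c). coord i c) ` (UNIV \<times> D) \<Longrightarrow> x \<le> m"
    by (metis bdd_above.E bdd_above_finite)
  have "coord i c < m + 1" if "c \<in> D" for i c
    using m[of "coord i c"] that by force
  then show thesis by (rule that)
qed

text \<open>A homomorphism is determined on the exponents of \<open>E\<close> in a box: beyond the box, an
  exponent of \<open>E\<close> can be lowered within \<open>E\<close>.\<close>
lemma T_box:
  obtains B :: "degree3 set" where "finite B" "B \<subseteq> E"
    "\<And>S (f :: _ \<Rightarrow> 'k::field) b c. f \<in> T S \<Longrightarrow> f (b, c) \<noteq> 0 \<Longrightarrow> \<exists>b'\<in>B. \<exists>c'\<in>D. f (b', c') \<noteq> 0 \<and> c' - b' = c - b"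
proof -
  obtain m where m: "\<And>c i. c \<in> D \<Longrightarrow> coord i c < m" using D_bounded by blast
  define B where "B = {b \<in> E. \<forall>i. coord i b \<le> m}"
  have "B \<subseteq> {0..m} \<times> {0..m} \<times> {0..m}"
  proof
    fix b assume "b \<in> B"
    then have "0 \<le> coord i b \<and> coord i b \<le> m" for i by (simp add: B_def E_nonneg)
    from this[of X1] this[of X2] this[of X3] show "b \<in> {0..m} \<times> {0..m} \<times> {0..m}"
      by (cases b) auto
  qed
  then have "finite B" by (rule finite_subset) auto
  moreover have "B \<subseteq> E" by (auto simp: B_def)
  moreover have "\<exists>b'\<in>B. \<exists>c'\<in>D. f (b', c') \<noteq> 0 \<and> c' - b' = c - b"
    if "f \<in> T S" "f (b, c) \<noteq> 0" for S and f :: "_ \<Rightarrow> 'k" and b c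
    using that(2)
  proof (induction "nat (coord X1 b + coord X2 b + coord X3 b)" arbitrary: b c rule: less_induct)
    case less
    note bc = T_support[OF that(1) less.prems]
    show ?case
    proof (cases "b \<in> B")
      case True
      then show ?thesis using bc less.prems by blast
    next
      case False
      then obtain i where i: "m < coord i b" using bc by (auto simp: B_def not_le)
      let ?b = "shift i (-1) b" and ?c = "shift i (-1) c"
      have "0 \<le> m" using m[of c i] D_nonneg[of c i] bc by linarith
      have b': "?b \<in> E"
        using bc i \<open>0 \<le> m\<close> m[of ?b i] by (auto simp: E_def coord_shift)
      have nz: "f (?b, ?c) \<noteq> 0"
        using T_shift[OF that(1) b', of c i] less.prems bc by simp
      have "nat (coord X1 ?b + coord X2 ?b + coord X3 ?b) < nat (coord X1 b + coord X2 b + coord X3 b)"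
        using E_nonneg[of b X1] E_nonneg[of b X2] E_nonneg[of b X3] bc i \<open>0 \<le> m\<close>
        by (cases i) (auto simp: coord_shift)
      from less.hyps[OF this nz] show ?thesis by simp
    qed
  qed
  ultimately show thesis by (rule that)
qed

text \<open>Values on the finite box determine an element of \<open>T S\<close>, so coordinates can
  be chosen among them. Their location in \<open>E\<close> x \<open>D\<close> keeps them apart from
  \<open>pairs S\<close>.\<close>

lemma T_coords:
  obtains Q where "free_coords (T S :: (_ \<Rightarrow> 'k::field) set) Q" "Q \<subseteq> E \<times> D"
proof -
  obtain B where B: "finite B" "B \<subseteq> E"
    "\<And>S (f :: _ \<Rightarrow> 'k) b c. f \<in> T S \<Longrightarrow> f (b, c) \<noteq> 0 \<Longrightarrow> \<exists>b'\<in>B. \<exists>c'\<in>D. f (b', c') \<noteq> 0 \<and> c' - b' = c - b"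
    using T_box by metis
  have det: "f = (\<lambda>_. 0)" if "f \<in> T S" "\<And>q. q \<in> B \<times> D \<Longrightarrow> f q = 0" for f :: "_ \<Rightarrow> 'k"
  proof
    show "f p = 0" for p using B(3)[OF that(1)] that(2) by (cases p) blast
  qed
  obtain Q where "Q \<subseteq> B \<times> D" "free_coords (T S :: (_ \<Rightarrow> 'k) set) Q"
    using free_coords_exists[OF lin_subspace_T _ det] B(1) finite_D by (metis finite_cartesian_product)
  then show thesis using B(2) by (intro that[of Q]) auto
qed

text \<open>The relations in \<open>Z S\<close> start at exponents of \<open>E\<close> and move up
  within \<open>E\<close>, so they never touch a value at an exponent of \<open>D\<close>.\<close>

lemma Z_coords:
  assumes Q: "free_coords (T S :: (_ \<Rightarrow> 'k::field) set) Q" "Q \<subseteq> E \<times> D"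
  shows "free_coords (Z S :: (_ \<Rightarrow> 'k) set) (Q \<union> pairs S)"
proof (rule free_coordsI[OF lin_subspace_Z])
  show "finite (Q \<union> pairs S)" using Q(1) finite_pairs by (simp add: free_coords_def)
  fix q assume q: "q \<in> Q \<union> pairs S"
  show "\<exists>u\<in>Z S. \<forall>r\<in>Q \<union> pairs S. u r = (if r = q then 1 else (0::'k))"
  proof (cases "q \<in> Q")
    case True
    obtain u where u: "u \<in> T S" "\<And>r. r \<in> Q \<Longrightarrow> u r = (if r = q then 1 else (0::'k))"
      using free_coords_unit[OF Q(1) True] by metis
    have "u r = 0" if "r \<in> pairs S" for r
    proof -
      obtain b c where "r = (b, c)" by (cases r)
      then show ?thesis
        using T_support[OF u(1), of b c] D_E_disjoint[of b] that unfolding pairs_def by blast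
    qed
    moreover have "r \<notin> Q" if "r \<in> pairs S" for r
      using that Q(2) D_E_disjoint by (auto simp: pairs_def)
    moreover have "u \<in> Z S" using u(1) T_subset_Z by blast
    ultimately show ?thesis using u(2) True by (intro bexI[of _ u]) auto
  next
    case False
    then have q': "q \<in> pairs S" using q by simp
    obtain b0 c0 where bc: "q = (b0, c0)" "b0 \<in> D" "c0 \<in> D" "c0 - b0 \<in> S"
      using q' by (auto simp: pairs_def)
    have "b \<noteq> b0" "shift i 1 b \<noteq> b0" if "b \<in> E" for i b
      using that E_up[OF that, of i] bc(2) D_E_disjoint by metis+
    then have "(\<lambda>r. if r = q then 1 else 0) \<in> Z S"
      using bc by (simp add: Z_def)
    then show ?thesis by (intro bexI[of _ "\<lambda>r. if r = q then 1 else 0"]) auto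
  qed
next
  fix f :: "_ \<Rightarrow> 'k" assume f: "f \<in> Z S" "\<And>q. q \<in> Q \<union> pairs S \<Longrightarrow> f q = 0"
  have "f \<in> T S"
    unfolding T_def mem_Collect_eq
  proof (intro conjI allI ballI impI)
    fix b c assume "f (b, c) \<noteq> 0"
    with Z_support[OF f(1) this] f(2)[of "(b, c)"] show "b \<in> E" "c \<in> D" "c - b \<in> S"
      by (auto simp: pairs_def)
  qed (rule Z_shift[OF f(1)])
  then show "f = (\<lambda>_. 0)"
    using f(2) by (intro free_coords_eqI[OF Q(1)] lin_subspace_zero[OF lin_subspace_T]) auto
qed

section \<open>The comparison of extended homomorphisms with cocycles\<close>

definition differential ::
    "(degree3 \<times> degree3 \<Rightarrow> 'k::field) \<Rightarrow> axis \<times> degree3 \<times> degree3 \<Rightarrow> 'k" where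
  "differential f = (\<lambda>(i, b, c). if b \<in> D \<and> c \<in> D then diff i f b c else 0)"

lemma differential_zero: "differential (\<lambda>_. 0) = (\<lambda>_. 0)"
  by (auto simp: differential_def diff_zero)

lemma diff_Z_support:
  assumes "f \<in> Z S" "diff i f b c \<noteq> 0" "b \<in> D \<union> E" "c \<in> D"
  shows "b \<in> D \<and> c \<in> D \<and> shift i (-1) (c - b) \<in> S"
proof -
  have "b \<notin> E" using assms Z_shift[OF assms(1), of b c i] by (auto simp: diff_def)
  moreover have "f (b, shift i (-1) c) \<noteq> 0 \<or> f (shift i 1 b, c) \<noteq> 0"
    using assms(2) by (auto simp: diff_def)
  then have "shift i (-1) (c - b) \<in> S"
    using Z_support[OF assms(1), of b "shift i (-1) c"] Z_support[OF assms(1), of "shift i 1 b" c]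
    by auto
  ultimately show ?thesis using assms by blast
qed

text \<open>Differences along two axes commute, so only the cutoff to \<open>D\<close> x
  \<open>D\<close> needs an argument. Where a neighbour leaves \<open>D\<close> x \<open>D\<close>,
  the uncut difference vanishes as well: a lowered \<open>c\<close> leaves the support, and a raised
  \<open>b\<close> enters \<open>E\<close>, where the relations of \<open>Z S\<close> cancel the two
  values.\<close>

lemma differential_K:
  assumes f: "f \<in> Z S"
  shows "differential f \<in> K S"
  unfolding K_def mem_Collect_eq
proof (intro conjI allI ballI impI)
  fix p assume "p \<notin> arrows S"
  then show "differential f p = 0"
  proof -
    obtain j b c where p: "p = (j, b, c)" using prod_cases3 by blast
    show ?thesis
      using diff_Z_support[OF f, of j b c] \<open>p \<notin> arrows S\<close>
      unfolding p by (auto simp: differential_def arrows_def)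
  qed
next
  fix i j b c assume bc: "b \<in> D" "c \<in> D"
  have dd: "diff i (\<lambda>p. differential f (j, p)) b c = diff i (\<lambda>(b, c). diff j f b c) b c" for i j
  proof -
    have "differential f (j, b, shift i (-1) c) = diff j f b (shift i (-1) c)"
    proof (cases "shift i (-1) c \<in> D")
      case False
      have "f (u, shift i (-1) c) = 0" for u
        using Z_support[OF f, of u] False by blast
      moreover have "f (u, shift j (-1) (shift i (-1) c)) = 0" for u
      proof (rule ccontr)
        assume "f (u, shift j (-1) (shift i (-1) c)) \<noteq> 0"
        then have "shift j (-1) (shift i (-1) c) \<in> D" using Z_support[OF f] by blast
        then have "0 \<le> coord i (shift j (-1) (shift i (-1) c))" by (rule D_nonneg)
        then have "1 \<le> coord i c" by (simp add: coord_shift split: if_splits)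
        then show False using D_down[OF bc(2)] False by blast
      qed
      ultimately show ?thesis using False by (simp add: differential_def diff_def)
    qed (simp add: differential_def bc)
    moreover have "differential f (j, shift i 1 b, c) = diff j f (shift i 1 b) c"
    proof (cases "shift i 1 b \<in> D")
      case False
      have "0 \<le> coord k (shift i 1 b)" for k
        using D_nonneg[OF bc(1), of k] by (auto simp: coord_shift)
      then have "shift i 1 b \<in> E" using False D_E_cases by blast
      then show ?thesis
        using Z_shift[OF f _ bc(2)] False by (simp add: differential_def diff_def)
    qed (simp add: differential_def bc)
    ultimately show ?thesis by (simp add: diff_def)
  qed
  show "diff i (\<lambda>p. differential f (j, p)) b c = diff j (\<lambda>p. differential f (i, p)) b c"
    unfolding dd by (simp add: diff_def shift_commute[of i _ j] algebra_simps)
qed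

text \<open>A vanishing differential supplies at exponents of \<open>D\<close> the relation that
  \<open>Z S\<close> imposes at exponents of \<open>E\<close>.\<close>

lemma Z_shift_all:
  assumes f: "f \<in> Z S" and "differential f = (\<lambda>_. 0)" and b: "b \<in> D \<union> E" and c: "c \<in> D"
  shows "f (shift i 1 b, c) = f (b, shift i (-1) c)"
proof (cases "b \<in> D")
  case True
  then have "diff i f b c = 0"
    using fun_cong[OF assms(2), of "(i, b, c)"] c by (simp add: differential_def)
  then show ?thesis by (simp add: diff_def)
next
  case False
  then show ?thesis using Z_shift[OF f _ c] b by blast
qed

text \<open>Degrees negative along the axis \<open>i\<close> force \<open>f (b, c) = 0\<close> by moving \<open>b\<close> and \<open>c\<close>
  down along that axis until \<open>c\<close> leaves the octant.\<close>
lemma differential_inj: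
  assumes f: "f \<in> Z S" and df: "differential f = (\<lambda>_. 0)" and S: "\<And>a. a \<in> S \<Longrightarrow> coord i a < 0"
  shows "f = (\<lambda>_. 0)"
proof (rule ccontr)
  assume "f \<noteq> (\<lambda>_. 0)"
  then obtain b c where "f (b, c) \<noteq> 0" by (metis ext surj_pair)
  then show False
  proof (induction "nat (coord i c)" arbitrary: b c rule: less_induct)
    case less
    note bc = Z_support[OF f less.prems]
    have c0: "0 \<le> coord i c" "coord i c < coord i b"
      using D_nonneg[of c] bc S[of "c - b"] by (auto simp: coord_diff)
    have nonneg: "0 \<le> coord k (shift i (-1) b)" for k
      using bc c0 D_nonneg[of b k] E_nonneg[of b k] by (auto simp: coord_shift)
    have nz: "f (shift i (-1) b, shift i (-1) c) \<noteq> 0"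
      using Z_shift_all[OF f df, of "shift i (-1) b" c i] D_E_cases[OF nonneg] bc less.prems by simp
    then have "0 \<le> coord i (shift i (-1) c)" using Z_support[OF f nz] D_nonneg by blast
    then have "nat (coord i (shift i (-1) c)) < nat (coord i c)" by (simp add: coord_shift)
    then show False using less.hyps nz by blast
  qed
qed

text \<open>The inverse of the differential, a telescoping sum along the axis \<open>i\<close>.\<close>
definition primitive ::
    "axis \<Rightarrow> (axis \<times> degree3 \<times> degree3 \<Rightarrow> 'k::field) \<Rightarrow> degree3 \<times> degree3 \<Rightarrow> 'k" where
  "primitive i g = (\<lambda>(b, c). if b \<in> D \<union> E \<and> c \<in> D
     then - (\<Sum>t<Suc (nat (coord i c)). g (i, shift i (- int t - 1) b, shift i (- int t) c)) else 0)"

lemma D_down_iterate: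
  assumes "c \<in> D" "int t \<le> coord i c"
  shows "shift i (- int t) c \<in> D"
  using assms(2)
proof (induction t)
  case (Suc t)
  then have "shift i (- int t) c \<in> D" by simp
  then show ?case
    using D_down[of "shift i (- int t) c" i] Suc.prems by (simp add: coord_shift algebra_simps)
qed (simp add: assms(1))

lemma K_zero_nonneg:
  assumes "g \<in> K S" "coord k b < 0 \<or> coord k c < 0"
  shows "g (i, b, c) = 0"
proof (rule ccontr)
  assume "g (i, b, c) \<noteq> 0"
  then have "b \<in> D" "c \<in> D" using K_support[OF assms(1)] by blast+
  then show False using D_nonneg[of b k] D_nonneg[of c k] assms(2) by linarith
qed

lemma K_zero_E: "g \<in> K S \<Longrightarrow> b \<in> E \<Longrightarrow> g (i, b, c) = 0"
  using K_support D_E_disjoint by blast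

text \<open>Terms beyond the cutoff have a negative coordinate and vanish. Hence neighbouring points
  can share one number \<open>N\<close> of summands, and their sums can be subtracted term by term.
  The second alternative for \<open>c\<close> covers a lowered exponent that leaves the
  octant.\<close>

lemma primitive_eq_sum:
  assumes g: "g \<in> K S" and b: "b \<in> D \<union> E" and c: "c \<in> D \<or> (\<exists>k. coord k c < 0)"
    and N: "coord i c < int N"
  shows "primitive i g (b, c) = - (\<Sum>t<N. g (i, shift i (- int t - 1) b, shift i (- int t) c))"
proof (cases "c \<in> D")
  case True
  have "(\<Sum>t<N. g (i, shift i (- int t - 1) b, shift i (- int t) c)) =
      (\<Sum>t<Suc (nat (coord i c)). g (i, shift i (- int t - 1) b, shift i (- int t) c))"
  proof (rule sum.mono_neutral_right)
    show "{..<Suc (nat (coord i c))} \<subseteq> {..<N}" using N D_nonneg[OF True, of i] by auto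
    show "\<forall>t\<in>{..<N} - {..<Suc (nat (coord i c))}. g (i, shift i (- int t - 1) b, shift i (- int t) c) = 0"
      by (intro ballI K_zero_nonneg[OF g, of i]) (auto simp: coord_shift)
  qed simp
  then show ?thesis using b True unfolding primitive_def by simp
next
  case False
  then obtain k where k: "coord k c < 0" using c by blast
  have "g (i, shift i (- int t - 1) b, shift i (- int t) c) = 0" for t
    using k by (intro K_zero_nonneg[OF g, of k]) (auto simp: coord_shift)
  then show ?thesis using False by (simp add: primitive_def)
qed

text \<open>The cocycle equation trades the difference along \<open>j\<close> of component
  \<open>i\<close> for the difference along \<open>i\<close> of component \<open>j\<close>; after
  this exchange the sum along the axis \<open>i\<close> telescopes.\<close>

lemma diff_primitive:
  assumes g: "g \<in> K S" and S: "\<And>a. a \<in> S \<Longrightarrow> coord i a < 0"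
    and b: "b \<in> D \<union> E" and c: "c \<in> D"
  shows "diff j (primitive i g) b c = g (j, b, c)"
proof -
  define N where "N = Suc (nat (coord i c))"
  have N: "coord i c < int N" using D_nonneg[OF c, of i] by (simp add: N_def)
  have bj: "shift j 1 b \<in> D \<union> E"
    using b D_nonneg[of b] E_nonneg[of b] D_E_cases[of "shift j 1 b"] by (force simp: coord_shift)
  have cj: "shift j (-1) c \<in> D \<or> (\<exists>k. coord k (shift j (-1) c) < 0)"
  proof (cases "1 \<le> coord j c")
    case False
    then have "coord j (shift j (-1) c) < 0" by (simp add: coord_shift)
    then show ?thesis by blast
  qed (use D_down[OF c, of j] in blast)
  have cjN: "coord i (shift j (-1) c) < int N" using N by (auto simp: coord_shift)
  have "diff j (primitive i g) b c =
      - (\<Sum>t<N. diff j (\<lambda>p. g (i, p)) (shift i (- int t - 1) b) (shift i (- int t) c))"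
    unfolding diff_def primitive_eq_sum[OF g b cj cjN] primitive_eq_sum[OF g bj disjI1[OF c] N]
    by (simp add: shift_commute[of j] sum_subtractf)
  also have "(\<Sum>t<N. diff j (\<lambda>p. g (i, p)) (shift i (- int t - 1) b) (shift i (- int t) c)) =
      (\<Sum>t<N. diff i (\<lambda>p. g (j, p)) (shift i (- int t - 1) b) (shift i (- int t) c))"
  proof (intro sum.cong refl)
    fix t assume "t \<in> {..<N}"
    then have t: "int t \<le> coord i c" using D_nonneg[OF c, of i] by (auto simp: N_def)
    define b' where "b' = shift i (- int t - 1) b"
    have ct: "shift i (- int t) c \<in> D" by (rule D_down_iterate[OF c t])
    \<comment> \<open>The cocycle equation is available for \<open>b'\<close> in \<open>D\<close>.
      On \<open>E\<close> both sides vanish, and for \<open>i = j\<close> they coincide. Just below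
      the octant, raising \<open>b'\<close> along \<open>i\<close> may reach \<open>D\<close>; the
      resulting value has a degree that is nonnegative along \<open>i\<close>, so the sign condition
      on \<open>S\<close> makes it zero.\<close>
    consider "b' \<in> D" | "b' \<in> E" | "i = j" | "coord i b' < 0" "i \<noteq> j"
    proof -
      have "0 \<le> coord k b" for k using b D_nonneg[of b k] E_nonneg[of b k] by blast
      then have "0 \<le> coord k b'" if "0 \<le> coord i b'" for k
        using that by (auto simp: b'_def coord_shift)
      then show thesis using that D_E_cases[of b'] by (meson not_le)
    qed
    then show "diff j (\<lambda>p. g (i, p)) b' (shift i (- int t) c) = diff i (\<lambda>p. g (j, p)) b' (shift i (- int t) c)"
    proof cases
      case 1
      then show ?thesis using K_cocycle[OF g _ ct] by blast
    next
      case 2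
      then show ?thesis using E_up[OF 2] by (simp add: diff_def K_zero_E[OF g])
    next
      case 4
      have "g (j, shift i 1 b', shift i (- int t) c) = 0"
      proof (rule ccontr)
        assume "g (j, shift i 1 b', shift i (- int t) c) \<noteq> 0"
        then have "shift j (-1) (c - b) \<in> S"
          using K_support[OF g, of j "shift i 1 b'" "shift i (- int t) c"] by (simp add: b'_def)
        then show False
          using S 4 t by (fastforce simp: coord_shift coord_diff b'_def)
      qed
      moreover have "coord i (shift j 1 b') < 0" using 4 by (simp add: coord_shift)
      ultimately show ?thesis
        using 4 by (simp add: diff_def K_zero_nonneg[OF g, of i])
    qed simp
  qed
  also have "\<dots> = (\<Sum>t<N. g (j, shift i (- int (Suc t)) b, shift i (- int (Suc t)) c)
      - g (j, shift i (- int t) b, shift i (- int t) c))"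
  proof (intro sum.cong refl)
    have Suc: "- int (Suc t) = - int t - 1" for t by simp
    show "diff i (\<lambda>p. g (j, p)) (shift i (- int t - 1) b) (shift i (- int t) c) =
      g (j, shift i (- int (Suc t)) b, shift i (- int (Suc t)) c) -
      g (j, shift i (- int t) b, shift i (- int t) c)" for t
      unfolding Suc by (simp add: diff_def)
  qed
  also have "\<dots> = g (j, shift i (- int N) b, shift i (- int N) c) - g (j, b, c)"
    by (subst sum_lessThan_telescope) simp
  also have "g (j, shift i (- int N) b, shift i (- int N) c) = 0"
    using N by (intro K_zero_nonneg[OF g, of i]) (simp add: coord_shift)
  finally show ?thesis by simp
qed

text \<open>A cocycle is zero at exponents of \<open>E\<close>, so there the formula for the
  differences of the primitive is precisely the shift relation.\<close>

lemma primitive_Z: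
  assumes g: "g \<in> K S" and S: "\<And>a. a \<in> S \<Longrightarrow> coord i a < 0"
  shows "primitive i g \<in> Z S"
  unfolding Z_def mem_Collect_eq
proof (intro conjI allI impI ballI)
  fix b c assume nz: "primitive i g (b, c) \<noteq> 0"
  then show "b \<in> D \<union> E" "c \<in> D" by (auto simp: primitive_def split: if_splits)
  have "(\<Sum>t<Suc (nat (coord i c)). g (i, shift i (- int t - 1) b, shift i (- int t) c)) \<noteq> 0"
    using nz unfolding primitive_def case_prod_conv by (metis neg_equal_0_iff_equal)
  then obtain t where "g (i, shift i (- int t - 1) b, shift i (- int t) c) \<noteq> 0"
    by (rule sum.not_neutral_contains_not_neutral)
  from K_support[OF g this] show "c - b \<in> S" by simp
next
  fix k b c assume "b \<in> E" "c \<in> D"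
  then show "primitive i g (shift k 1 b, c) = primitive i g (b, shift k (- 1) c)"
    using diff_primitive[OF g S, of b c k] K_zero_E[OF g, of b k c] by (simp add: diff_def)
qed

lemma differential_primitive:
  assumes g: "g \<in> K S" and S: "\<And>a. a \<in> S \<Longrightarrow> coord i a < 0"
  shows "differential (primitive i g) = g"
proof
  fix p :: "axis \<times> degree3 \<times> degree3"
  obtain j b c where p: "p = (j, b, c)" using prod_cases3 by blast
  show "differential (primitive i g) p = g p"
    using diff_primitive[OF g S, of b c j] K_support[OF g, of j b c]
    unfolding p by (auto simp: differential_def)
qed

text \<open>Two injections give the two inequalities: \<open>differential\<close> is injective by
  the sign condition, and \<open>primitive\<close> has \<open>differential\<close> as a left
  inverse.\<close>

lemma card_Z_K:
  assumes Z: "free_coords (Z S :: (_ \<Rightarrow> 'k::field) set) Q"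
    and K: "free_coords (K S :: (_ \<Rightarrow> 'k) set) R"
    and S: "\<And>a. a \<in> S \<Longrightarrow> coord i a < 0"
  shows "card Q = card R"
proof (rule antisym)
  show "card Q \<le> card R"
  proof (rule free_coords_card_le[OF Z K])
    show "differential f = (\<lambda>_. 0) \<Longrightarrow> f = (\<lambda>_. 0)" if "f \<in> Z S" for f :: "_ \<Rightarrow> 'k"
      using differential_inj[OF that _ S] by blast
  qed (simp_all add: differential_K, auto simp: fun_eq_iff differential_def diff_add diff_smult)
  show "card R \<le> card Q"
  proof (rule free_coords_card_le[OF K Z])
    show "primitive i g = (\<lambda>_. 0) \<Longrightarrow> g = (\<lambda>_. 0)" if "g \<in> K S" for g :: "_ \<Rightarrow> 'k"
      using differential_primitive[OF that S] differential_zero by metis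
    show "primitive i g \<in> Z S" if "g \<in> K S" for g :: "_ \<Rightarrow> 'k"
      using that S by (rule primitive_Z)
  qed (auto simp: fun_eq_iff primitive_def sum.distrib sum_distrib_left simp del: sum.lessThan_Suc)
qed

text \<open>The cocycle equations of \<open>K S\<close>, one for each arrow of the dual degrees: \<open>(k, c, b)\<close> stands
  for the equation at \<open>(b, c)\<close> indexed by the two axes other than \<open>k\<close>. With this indexing the
  coefficients are symmetric.\<close>
definition cocycle_matrix ::
    "axis \<times> degree3 \<times> degree3 \<Rightarrow> axis \<times> degree3 \<times> degree3 \<Rightarrow> 'k::field" where
  "cocycle_matrix = (\<lambda>p (k, c, b). let i = next_axis k; j = next_axis i in
     of_bool (p = (j, b, shift i (-1) c)) - of_bool (p = (j, shift i 1 b, c))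
     - of_bool (p = (i, b, shift j (-1) c)) + of_bool (p = (i, shift j 1 b, c)))"

text \<open>Exchanging \<open>b\<close> and \<open>c\<close> turns each commutator into the negative
  of its transpose, and exchanging two axes changes the sign in the cyclic order of the equations.
  The two signs cancel.\<close>

lemma cocycle_matrix_symmetric: "cocycle_matrix p q = cocycle_matrix q p"
proof -
  obtain l u1 u2 u3 v1 v2 v3 where p: "p = (l, (u1, u2, u3), (v1, v2, v3))" by (metis prod_cases3)
  obtain k c1 c2 c3 b1 b2 b3 where q: "q = (k, (c1, c2, c3), (b1, b2, b3))" by (metis prod_cases3)
  show ?thesis
    unfolding p q by (cases k; cases l) (auto simp: cocycle_matrix_def)
qed

lemma sum_of_bool_delta:
  assumes "finite A" "\<And>p. p \<notin> A \<Longrightarrow> g p = (0::'k::field)"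
  shows "(\<Sum>p\<in>A. of_bool (p = p0) * g p) = g p0"
proof -
  have "(\<Sum>p\<in>A. of_bool (p = p0) * g p) = (\<Sum>p\<in>A. if p = p0 then g p else 0)"
    by (intro sum.cong) auto
  then show ?thesis using assms by simp
qed

lemma cocycle_matrix_sum:
  assumes "\<And>p. p \<notin> arrows S \<Longrightarrow> g p = (0::'k::field)"
  shows "(\<Sum>p\<in>arrows S. cocycle_matrix p (k, c, b) * g p) =
    diff (next_axis k) (\<lambda>p. g (next_axis (next_axis k), p)) b c
    - diff (next_axis (next_axis k)) (\<lambda>p. g (next_axis k, p)) b c"
  by (simp add: cocycle_matrix_def Let_def left_diff_distrib distrib_right sum.distrib sum_subtractf
      sum_of_bool_delta[OF finite_arrows assms] diff_def)

text \<open>Lowering along all three axes and raising again along \<open>k\<close> leaves the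
  lowerings along the two axes of the equation labelled by \<open>k\<close>.\<close>

lemma dual_arrows:
  "(k, c, b) \<in> arrows (dual_degrees S) \<longleftrightarrow>
     b \<in> D \<and> c \<in> D \<and> shift (next_axis k) (-1) (shift (next_axis (next_axis k)) (-1) (c - b)) \<in> S"
proof -
  have "(-1, -1, -1) - shift k (-1) (b - c) =
      shift (next_axis k) (-1) (shift (next_axis (next_axis k)) (-1) (c - b))"
    by (cases k; cases b; cases c) (auto simp: numeral_eq_Suc)
  then show ?thesis by (auto simp: arrows_def dual_degrees_def)
qed

text \<open>An equation whose degree is outside \<open>S\<close> involves four values of
  \<open>g\<close> that are all zero, and the remaining ones are labelled by the dual arrows. Two
  equal axes give a trivial equation, and interchanging the axes only interchanges the two
  sides.\<close>

lemma K_eq_matrix_kernel: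
  "(K S :: (_ \<Rightarrow> 'k::field) set) = matrix_kernel cocycle_matrix (arrows S) (arrows (dual_degrees S))"
proof (intro Set.set_eqI iffI)
  fix g :: "_ \<Rightarrow> 'k" assume g: "g \<in> K S"
  have zero: "p \<notin> arrows S \<Longrightarrow> g p = 0" for p using g by (simp add: K_def)
  have "(\<Sum>p\<in>arrows S. cocycle_matrix p q * g p) = 0" if q: "q \<in> arrows (dual_degrees S)" for q
  proof -
    obtain k c b where kcb: "q = (k, c, b)" using prod_cases3 by blast
    then have "b \<in> D" "c \<in> D" using q by (simp_all add: dual_arrows)
    then show ?thesis
      unfolding kcb using K_cocycle[OF g] by (simp add: cocycle_matrix_sum[OF zero])
  qed
  then show "g \<in> matrix_kernel cocycle_matrix (arrows S) (arrows (dual_degrees S))"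
    using zero by (simp add: matrix_kernel_def)
next
  fix g :: "_ \<Rightarrow> 'k"
  assume "g \<in> matrix_kernel cocycle_matrix (arrows S) (arrows (dual_degrees S))"
  then have zero: "\<And>p. p \<notin> arrows S \<Longrightarrow> g p = 0"
    and eqs: "\<And>q. q \<in> arrows (dual_degrees S) \<Longrightarrow> (\<Sum>p\<in>arrows S. cocycle_matrix p q * g p) = 0"
    by (simp_all add: matrix_kernel_def)
  have cyclic: "diff (next_axis k) (\<lambda>p. g (next_axis (next_axis k), p)) b c =
      diff (next_axis (next_axis k)) (\<lambda>p. g (next_axis k, p)) b c" if "b \<in> D" "c \<in> D" for k b c
  proof (cases "(k, c, b) \<in> arrows (dual_degrees S)")
    case True
    then show ?thesis using eqs[OF True] by (simp add: cocycle_matrix_sum[OF zero])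
  next
    case False
    let ?i = "next_axis k" and ?j = "next_axis (next_axis k)"
    have "shift ?i (-1) (shift ?j (-1) (c - b)) \<notin> S" using False that by (simp add: dual_arrows)
    then have "g (?j, b, shift ?i (-1) c) = 0" "g (?j, shift ?i 1 b, c) = 0"
      "g (?i, b, shift ?j (-1) c) = 0" "g (?i, shift ?j 1 b, c) = 0"
      by (auto simp: arrows_def shift_commute[of ?j] intro!: zero)
    then show ?thesis by (simp add: diff_def)
  qed
  show "g \<in> K S"
    unfolding K_def mem_Collect_eq
  proof (intro conjI allI ballI impI zero)
    fix i j b c assume bc: "b \<in> D" "c \<in> D"
    obtain k where "i = j \<or> i = next_axis k \<and> j = next_axis (next_axis k) \<or>
        j = next_axis k \<and> i = next_axis (next_axis k)"
      by (cases i; cases j) (metis next_axis.simps)+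
    then show "diff i (\<lambda>p. g (j, p)) b c = diff j (\<lambda>p. g (i, p)) b c"
      using cyclic[OF bc, of k] by metis
  qed
qed

lemma dual_degrees_dual: "dual_degrees (dual_degrees S) = S"
  by (simp add: dual_degrees_def)

text \<open>Both dimensions are a number of arrows minus the rank of one and the same matrix. The
  rank is eliminated, and the identity is written with sums to stay within the natural
  numbers.\<close>

lemma K_coords:
  obtains R R' where "free_coords (K S :: (_ \<Rightarrow> 'k::field) set) R"
    "free_coords (K (dual_degrees S) :: (_ \<Rightarrow> 'k) set) R'"
    "card R + card (arrows (dual_degrees S)) = card R' + card (arrows S)"
proof -
  let ?S' = "dual_degrees S"
  obtain A C where AC: "A \<subseteq> arrows S" "C \<subseteq> arrows ?S'" "card A = card C"
    "free_coords (matrix_kernel (cocycle_matrix :: _ \<Rightarrow> _ \<Rightarrow> 'k) (arrows S) (arrows ?S')) (arrows S - A)"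
    "free_coords (matrix_kernel (\<lambda>q p. cocycle_matrix p q :: 'k) (arrows ?S') (arrows S)) (arrows ?S' - C)"
    using matrix_kernel_rank[OF finite_arrows finite_arrows, of S ?S' cocycle_matrix] by blast
  have sym: "(\<lambda>q p. cocycle_matrix p q :: 'k) = cocycle_matrix"
    using cocycle_matrix_symmetric by blast
  have "card A \<le> card (arrows S)" "card C \<le> card (arrows ?S')"
    using AC(1,2) by (auto intro: card_mono finite_arrows)
  then show thesis
    using AC finite_subset[OF AC(1) finite_arrows] finite_subset[OF AC(2) finite_arrows]
    by (intro that[of "arrows S - A" "arrows ?S' - C"])
      (simp_all add: K_eq_matrix_kernel dual_degrees_dual sym card_Diff_subset)
qed

text \<open>The count below is the expansion of a product of differences, \<open>\<Prod>i. (s i - s i \<circ> pred)\<close>, for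
  the indicator functions of the three signs: such a difference is supported at \<open>0\<close>.\<close>
lemma card_pairs_arrows:
  assumes S: "S = {a. has_signature s a}"
    and s: "s \<in> {(letter_p, letter_p, letter_n), (letter_p, letter_n, letter_p), (letter_n, letter_p, letter_p)}"
  shows "card (pairs (dual_degrees S)) + card (arrows S) =
    card (pairs S) + card (arrows (dual_degrees S)) + card D"
proof -
  let ?I = "\<lambda>U a. of_bool (a \<in> U) :: nat" and ?S' = "dual_degrees S"
  have pairs: "card (pairs U) = (\<Sum>b\<in>D. \<Sum>c\<in>D. ?I U (c - b))" for U
  proof -
    have "pairs U = D \<times> D \<inter> {(b, c). c - b \<in> U}" by (auto simp: pairs_def)
    moreover have "(\<Sum>(b, c)\<in>D \<times> D. ?I U (c - b)) = card (D \<times> D \<inter> {(b, c). c - b \<in> U})"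
      using finite_D by (simp add: case_prod_unfold sum_of_bool_eq)
    ultimately show ?thesis by (simp add: sum.cartesian_product)
  qed
  have arrows: "card (arrows U) = (\<Sum>b\<in>D. \<Sum>c\<in>D. \<Sum>i\<in>UNIV. ?I U (shift i (-1) (c - b)))" for U
  proof -
    have "arrows U = UNIV \<times> D \<times> D \<inter> {(i, b, c). shift i (-1) (c - b) \<in> U}"
      by (auto simp: arrows_def)
    moreover have "(\<Sum>(i, b, c)\<in>UNIV \<times> D \<times> D. ?I U (shift i (-1) (c - b))) =
        card (UNIV \<times> D \<times> D \<inter> {(i, b, c). shift i (-1) (c - b) \<in> U})"
      using finite_D by (simp add: case_prod_unfold sum_of_bool_eq)
    ultimately have "card (arrows U) = (\<Sum>i\<in>UNIV. \<Sum>b\<in>D. \<Sum>c\<in>D. ?I U (shift i (-1) (c - b)))"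
      by (simp add: sum.cartesian_product)
    also have "\<dots> = (\<Sum>b\<in>D. \<Sum>i\<in>UNIV. \<Sum>c\<in>D. ?I U (shift i (-1) (c - b)))"
      by (rule sum.swap)
    also have "\<dots> = (\<Sum>b\<in>D. \<Sum>c\<in>D. \<Sum>i\<in>UNIV. ?I U (shift i (-1) (c - b)))"
      by (intro sum.cong refl sum.swap)
    finally show ?thesis .
  qed
  \<comment> \<open>Rewritten as conditions on \<open>a\<close> for the signature \<open>s\<close>,
    the four terms lower three, one, none and two of the coordinates by 1. At 0 the factor of a
    letter p is 1 and that of n is -1; the single n therefore puts \<open>of_bool (a = 0)\<close> on
    the right.\<close>
  have pointwise: "?I ?S' (- a) + (\<Sum>i\<in>UNIV. ?I S (shift i (-1) a)) =
      ?I S a + (\<Sum>i\<in>UNIV. ?I ?S' (shift i (-1) (- a))) + of_bool (a = 0)" for a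
  proof -
    obtain x y z where a: "a = (x, y, z)" by (cases a)
    have cases: "x < 0 \<or> x = 0 \<or> 0 < x" "y < 0 \<or> y = 0 \<or> 0 < y" "z < 0 \<or> z = 0 \<or> 0 < z"
      by linarith+
    show ?thesis
      using s cases unfolding a S UNIV_axis
      by (elim insertE disjE emptyE)
        (simp_all add: dual_degrees_def zero_prod_def uminus_prod_def)
  qed
  \<comment> \<open>The pairs for the dual degrees are read with \<open>b\<close> and
    \<open>c\<close> exchanged, which negates the difference \<open>c - b\<close>.\<close>
  have "card (pairs ?S') + card (arrows S) =
      (\<Sum>b\<in>D. \<Sum>c\<in>D. ?I ?S' (- (c - b)) + (\<Sum>i\<in>UNIV. ?I S (shift i (-1) (c - b))))"
    unfolding pairs arrows sum.distrib by (subst sum.swap) simp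
  also have "\<dots> = (\<Sum>b\<in>D. \<Sum>c\<in>D. ?I S (c - b) + (\<Sum>i\<in>UNIV. ?I ?S' (shift i (-1) (- (c - b))))
      + of_bool (c = b))"
    unfolding pointwise by simp
  also have "\<dots> = card (pairs S) + card (arrows ?S') + card D"
  proof -
    have "(\<Sum>b\<in>D. \<Sum>c\<in>D. \<Sum>i\<in>UNIV. ?I ?S' (shift i (-1) (- (c - b)))) = card (arrows ?S')"
      unfolding arrows by (subst sum.swap) simp
    moreover have "(\<Sum>b\<in>D. \<Sum>c\<in>D. of_bool (c = b)) = card D"
      using finite_D by simp
    ultimately show ?thesis unfolding pairs sum.distrib by simp
  qed
  finally show ?thesis .
qed

theorem card_T_coords:
  assumes s: "s \<in> {(letter_p, letter_p, letter_n), (letter_p, letter_n, letter_p), (letter_n, letter_p, letter_p)}"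
    and S: "S = {a. has_signature s a}"
    and Q: "free_coords (T S :: (_ \<Rightarrow> 'k::field) set) Q" "Q \<subseteq> E \<times> D"
    and Q': "free_coords (T (dual_degrees S) :: (_ \<Rightarrow> 'k) set) Q'" "Q' \<subseteq> E \<times> D"
  shows "card Q = card Q' + card D"
proof -
  obtain R R' where R: "free_coords (K S :: (_ \<Rightarrow> 'k) set) R"
    "free_coords (K (dual_degrees S) :: (_ \<Rightarrow> 'k) set) R'"
    "card R + card (arrows (dual_degrees S)) = card R' + card (arrows S)"
    by (rule K_coords)
  have split: "card (P \<union> pairs U) = card P + card (pairs U)"
    if "free_coords (T U :: (_ \<Rightarrow> 'k) set) P" "P \<subseteq> E \<times> D" for P U
  proof -
    have "P \<inter> pairs U = {}" using that(2) D_E_disjoint by (auto simp: pairs_def)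
    then show ?thesis
      using that(1) finite_pairs by (intro card_Un_disjoint) (auto simp: free_coords_def)
  qed
  obtain i where i: "\<And>a. a \<in> S \<Longrightarrow> coord i a < 0"
  proof -
    have "\<exists>i. \<forall>a\<in>S. coord i a < 0"
      using s unfolding S by (elim insertE emptyE) (force intro: exI[of _ X1] exI[of _ X2] exI[of _ X3])+
    then show thesis using that by blast
  qed
  obtain i' where i': "\<And>a. a \<in> dual_degrees S \<Longrightarrow> coord i' a < 0"
  proof -
    have "\<exists>i. \<forall>a\<in>dual_degrees S. coord i a < 0"
      using s unfolding S dual_degrees_def
      by (elim insertE emptyE) (force intro: exI[of _ X1] exI[of _ X2] exI[of _ X3])+
    then show thesis using that by blast
  qed
  have "card Q + card (pairs S) = card R"
    using card_Z_K[OF Z_coords[OF Q] R(1) i] split[OF Q] by simp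
  moreover have "card Q' + card (pairs (dual_degrees S)) = card R'"
    using card_Z_K[OF Z_coords[OF Q'] R(2) i'] split[OF Q'] by simp
  ultimately show ?thesis
    using R(3) card_pairs_arrows[OF S s] by linarith
qed

end

section \<open>Homomorphisms into the quotient by a monomial ideal\<close>

lemma poly_mapping_sum_single:
  assumes "finite A" "Poly_Mapping.keys p \<subseteq> A"
  shows "p = (\<Sum>k\<in>A. Poly_Mapping.single k (Poly_Mapping.lookup p k))"
proof (rule poly_mapping_eqI)
  fix k
  have "(\<Sum>j\<in>A. Poly_Mapping.lookup (Poly_Mapping.single j (Poly_Mapping.lookup p j)) k) =
      (\<Sum>j\<in>A. if k = j then Poly_Mapping.lookup p j else 0)"
    by (intro sum.cong) (auto simp: lookup_single)
  then show "Poly_Mapping.lookup p k =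
      Poly_Mapping.lookup (\<Sum>k\<in>A. Poly_Mapping.single k (Poly_Mapping.lookup p k)) k"
    using assms by (auto simp: lookup_sum in_keys_iff)
qed

lemma lookup_single_times:
  fixes q :: "'k::field poly3"
  shows "Poly_Mapping.lookup (Poly_Mapping.single a s * q) g =
    (\<Sum>c\<in>Poly_Mapping.keys q. if a + c = g then s * Poly_Mapping.lookup q c else 0)"
proof -
  have "Poly_Mapping.single a s * q =
      (\<Sum>c\<in>Poly_Mapping.keys q. Poly_Mapping.single (a + c) (s * Poly_Mapping.lookup q c))"
    by (subst poly_mapping_sum_single[of "Poly_Mapping.keys q" q])
      (simp_all add: sum_distrib_left mult_single)
  then show ?thesis by (simp add: lookup_sum lookup_single when_def)
qed

lemma lookup_single_times_add:
  fixes q :: "'k::field poly3"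
  shows "Poly_Mapping.lookup (Poly_Mapping.single a s * q) (a + c) = s * Poly_Mapping.lookup q c"
  by (simp add: lookup_single_times in_keys_iff)

lemma lookup_single_times_zero:
  fixes q :: "'k::field poly3"
  assumes "\<And>c. c \<in> Poly_Mapping.keys q \<Longrightarrow> g \<noteq> a + c"
  shows "Poly_Mapping.lookup (Poly_Mapping.single a s * q) g = 0"
  unfolding lookup_single_times using assms by (intro sum.neutral) force

locale monomial_point =
  fixes I :: "'k::field poly3 set"
  assumes monomial: "monomial_ideal I"
begin

sublocale idl: ideal I "poly_ring :: 'k poly3 ring"
proof -
  obtain B where "I = Idl\<^bsub>poly_ring\<^esub> (monom3 ` B)" using monomial by (auto simp: monomial_ideal_def)
  then show "ideal I (poly_ring :: 'k poly3 ring)" by (simp add: ring.genideal_ideal[OF class_ring.ring_axioms])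
qed

definition In :: "expo set" where
  "In = {\<beta>. monom3 \<beta> \<in> I}"

lemma I_zero: "0 \<in> I"
  using additive_subgroup.zero_closed[OF idl.is_additive_subgroup] by simp

lemma I_add: "p \<in> I \<Longrightarrow> q \<in> I \<Longrightarrow> p + q \<in> I"
  using additive_subgroup.a_closed[OF idl.is_additive_subgroup] by simp

lemma I_mult: "p \<in> I \<Longrightarrow> q * p \<in> I"
  using idl.I_l_closed by simp

lemma I_sum: "(\<And>a. a \<in> A \<Longrightarrow> f a \<in> I) \<Longrightarrow> sum f A \<in> I"
  by (induction A rule: infinite_finite_induct) (auto simp: I_zero I_add)

lemma I_diff: "p \<in> I \<Longrightarrow> q \<in> I \<Longrightarrow> p - q \<in> I"
  using I_add[OF _ I_mult, of p q "-1"] by simp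

lemma single_eq_monom3: "Poly_Mapping.single \<beta> c = const3 c * (monom3 \<beta> :: 'k poly3)"
  by (simp add: const3_def monom3_def mult_single)

text \<open>The polynomials all of whose exponents are multiples of generator exponents form an
  ideal \<open>J\<close> that contains the generators, hence \<open>I\<close>. Conversely, a
  polynomial is the sum of its terms.\<close>

lemma mem_I_iff: "p \<in> I \<longleftrightarrow> Poly_Mapping.keys p \<subseteq> In"
proof
  assume "Poly_Mapping.keys p \<subseteq> In"
  then have "(\<Sum>k\<in>Poly_Mapping.keys p. Poly_Mapping.single k (Poly_Mapping.lookup p k)) \<in> I"
    unfolding single_eq_monom3 by (intro I_sum I_mult) (auto simp: In_def)
  then show "p \<in> I" using poly_mapping_sum_single[of "Poly_Mapping.keys p" p] by simp
next
  obtain B where B: "I = Idl\<^bsub>poly_ring\<^esub> (monom3 ` B)" using monomial by (auto simp: monomial_ideal_def)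
  define J where "J = {p :: 'k poly3. \<forall>\<beta>\<in>Poly_Mapping.keys p. \<exists>b\<in>B. \<exists>a. \<beta> = a + b}"
  have "ideal J (poly_ring :: 'k poly3 ring)"
  proof (rule idealI)
    show "ring (poly_ring :: 'k poly3 ring)" by (rule class_ring.ring_axioms)
    show "subgroup J (add_monoid (poly_ring :: 'k poly3 ring))"
    proof
      show "inv\<^bsub>add_monoid poly_ring\<^esub> p \<in> J" if "p \<in> J" for p
      proof -
        have "\<ominus>\<^bsub>poly_ring\<^esub> p = - p"
          using abelian_group.minus_equality[OF ring.axioms(1)[OF class_ring.ring_axioms], of "- p" p]
          by simp
        then show ?thesis using that by (simp add: a_inv_def J_def keys_def)
      qed
      show "p \<otimes>\<^bsub>add_monoid poly_ring\<^esub> q \<in> J" if "p \<in> J" "q \<in> J" for p q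
        using that Poly_Mapping.keys_add[of p q] by (simp add: J_def) blast
    qed (simp_all add: J_def)
    have mult: "x * p \<in> J" if p: "p \<in> J" for p x
      unfolding J_def mem_Collect_eq
    proof
      fix \<beta> assume "\<beta> \<in> Poly_Mapping.keys (x * p)"
      then obtain a c where ac: "\<beta> = a + c" "c \<in> Poly_Mapping.keys p" using keys_mult[of x p] by blast
      then obtain b d where "b \<in> B" "c = d + b" using p unfolding J_def by blast
      then have "\<beta> = (a + d) + b" using ac(1) by (simp only: add.assoc)
      then show "\<exists>b\<in>B. \<exists>a. \<beta> = a + b" using \<open>b \<in> B\<close> by blast
    qed
    show "x \<otimes>\<^bsub>poly_ring\<^esub> p \<in> J" "p \<otimes>\<^bsub>poly_ring\<^esub> x \<in> J" if "p \<in> J" for p x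
      using mult[OF that, of x] by (simp_all add: mult.commute)
  qed
  moreover have "monom3 b \<in> J" if "b \<in> B" for b
  proof -
    have "\<exists>b'\<in>B. \<exists>a. b = a + b'" using that by (intro bexI[of _ b] exI[of _ 0]) simp_all
    then show ?thesis by (simp add: J_def monom3_def)
  qed
  then have "monom3 ` B \<subseteq> J" by blast
  ultimately have "I \<subseteq> J" unfolding B by (rule ring.genideal_minimal[OF class_ring.ring_axioms])
  have "monom3 b \<in> I" if "b \<in> B" for b
    unfolding B using ring.genideal_self[OF class_ring.ring_axioms, of "monom3 ` B"] that by auto
  then have mem: "monom3 (a + b) \<in> I" if "b \<in> B" for a b
    using I_mult[of "monom3 b" "monom3 a"] that by (simp add: monom3_def mult_single)
  assume "p \<in> I"
  with \<open>I \<subseteq> J\<close> have "p \<in> J" by blast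
  show "Poly_Mapping.keys p \<subseteq> In"
  proof
    fix \<beta> assume "\<beta> \<in> Poly_Mapping.keys p"
    then obtain a b where "b \<in> B" "\<beta> = a + b" using \<open>p \<in> J\<close> unfolding J_def by blast
    then show "\<beta> \<in> In" using mem[of b a] by (simp add: In_def)
  qed
qed

lemma In_up: "b \<in> In \<Longrightarrow> a + b \<in> In"
  using I_mult[of "monom3 b" "monom3 a"] by (simp add: In_def monom3_def mult_single)

abbreviation cls :: "'k poly3 \<Rightarrow> 'k poly3 set" where
  "cls p \<equiv> I +>\<^bsub>poly_ring\<^esub> p"

lemma cls_eq_iff: "cls p = cls q \<longleftrightarrow> p - q \<in> I"
proof -
  have mem: "x \<in> cls r \<longleftrightarrow> x - r \<in> I" for x r
    unfolding a_r_coset_def' by (auto intro: bexI[of _ "x - r"])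
  have "p - q \<in> I" if "cls p = cls q" using that mem[of p p] mem[of p q] by (simp add: I_zero)
  moreover have "cls p = cls q" if pq: "p - q \<in> I"
  proof (rule Set.set_eqI)
    fix x show "x \<in> cls p \<longleftrightarrow> x \<in> cls q"
      using I_add[of "x - p" "p - q"] I_diff[of "x - q" "p - q"] pq by (auto simp: mem)
  qed
  ultimately show ?thesis by blast
qed

lemma carrier_quotient_module: "carrier (quotient_module I) = range cls"
  by (auto simp: quotient_module_def FactRing_def A_RCOSETS_def')

lemma zero_quotient_module: "\<zero>\<^bsub>quotient_module I\<^esub> = cls 0"
proof -
  have "cls 0 = I" unfolding a_r_coset_def' by auto
  then show ?thesis by (simp add: quotient_module_def FactRing_def)
qed

lemma add_quotient_module: "cls p \<oplus>\<^bsub>quotient_module I\<^esub> cls q = cls (p + q)"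
  using idl.a_rcos_sum[of p q] by (simp add: quotient_module_def FactRing_def)

lemma smult_quotient_module: "s \<odot>\<^bsub>quotient_module I\<^esub> cls p = cls (s * p)"
  using idl.rcoset_mult_add[of s p] by (simp add: quotient_module_def FactRing_def)

end

lemma lookup_Abs_poly_mapping_finite:
  assumes "finite {c. h c \<noteq> (0::'k::field)}"
  shows "Poly_Mapping.lookup (Abs_poly_mapping h) = h"
  using assms by (simp add: Abs_poly_mapping_inverse)

context monomial_point begin

text \<open>A class is recorded by its coefficients at standard monomials. Finite support is imposed
  because the set of standard monomials is not yet known to be finite.\<close>

lemma function_model_quotient:
  "function_model (quotient_space I) {h. finite {c. h c \<noteq> 0} \<and> (\<forall>c\<in>In. h c = 0)}
     (\<lambda>h. cls (Abs_poly_mapping h))" (is "function_model _ ?W ?mk")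
proof
  have lk: "Poly_Mapping.lookup (Abs_poly_mapping h) = h" if "h \<in> ?W" for h
    using that by (simp add: lookup_Abs_poly_mapping_finite)
  have fin: "finite {c. f c + g c \<noteq> 0}" if "finite {c. f c \<noteq> 0}" "finite {c. g c \<noteq> 0}" for f g :: "expo \<Rightarrow> 'k"
    using finite_subset[of "{c. f c + g c \<noteq> 0}" "{c. f c \<noteq> 0} \<union> {c. g c \<noteq> 0}"] that by fastforce
  show W: "lin_subspace ?W" using fin by (simp add: lin_subspace_def)
  show "carrier (quotient_space I) = ?mk ` ?W"
  proof -
    have "cls p \<in> ?mk ` ?W" for p
    proof -
      define h where "h = (\<lambda>c. if c \<in> In then 0 else Poly_Mapping.lookup p c)"
      have "finite {c. h c \<noteq> 0}"
        by (rule finite_subset[OF _ finite_keys[of p]]) (auto simp: h_def in_keys_iff)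
      then have h: "h \<in> ?W" by (simp add: h_def)
      have "p - Abs_poly_mapping h \<in> I"
        unfolding mem_I_iff using fun_cong[OF lk[OF h]]
        by (auto simp: in_keys_iff lookup_minus) (auto simp: h_def split: if_splits)
      then show ?thesis using h cls_eq_iff by blast
    qed
    then show ?thesis by (auto simp: restrict_scalars_def carrier_quotient_module)
  qed
  show "inj_on ?mk ?W"
  proof (intro inj_onI ext)
    fix f g c assume f: "f \<in> ?W" and g: "g \<in> ?W" and "?mk f = ?mk g"
    then have "Poly_Mapping.keys (Abs_poly_mapping f - Abs_poly_mapping g) \<subseteq> In"
      by (simp add: cls_eq_iff mem_I_iff)
    then have "c \<notin> In \<Longrightarrow> f c - g c = 0"
      using lk[OF f] lk[OF g] by (auto simp: subset_iff in_keys_iff lookup_minus)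
    then show "f c = g c" using f g by (cases "c \<in> In") auto
  qed
  show "\<zero>\<^bsub>quotient_space I\<^esub> = ?mk (\<lambda>_. 0)"
  proof -
    have "(0 :: 'k poly3) = Abs_poly_mapping (\<lambda>_. 0)"
      using lk[OF lin_subspace_zero[OF W]] by (intro poly_mapping_eqI) simp
    then show ?thesis by (simp add: restrict_scalars_def zero_quotient_module)
  qed
  fix f assume f: "f \<in> ?W"
  show "?mk f \<oplus>\<^bsub>quotient_space I\<^esub> ?mk g = ?mk (\<lambda>x. f x + g x)" if g: "g \<in> ?W" for g
  proof -
    have "Abs_poly_mapping f + Abs_poly_mapping g = Abs_poly_mapping (\<lambda>x. f x + g x)"
      using lk[OF f] lk[OF g] lk[OF lin_subspace_add[OF W f g]]
      by (intro poly_mapping_eqI) (simp add: lookup_add)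
    then show ?thesis by (simp add: restrict_scalars_def add_quotient_module)
  qed
  show "c \<odot>\<^bsub>quotient_space I\<^esub> ?mk f = ?mk (\<lambda>x. c * f x)" for c
  proof -
    have "const3 c * Abs_poly_mapping f = Abs_poly_mapping (\<lambda>x. c * f x)"
    proof (rule poly_mapping_eqI)
      fix x
      show "Poly_Mapping.lookup (const3 c * Abs_poly_mapping f) x =
          Poly_Mapping.lookup (Abs_poly_mapping (\<lambda>x. c * f x)) x"
        using lookup_single_times_add[of 0 c "Abs_poly_mapping f" x] lk[OF f]
          lk[OF lin_subspace_smult[OF W f]] by (simp add: const3_def)
    qed
    then show ?thesis by (simp add: restrict_scalars_def smult_quotient_module)
  qed
qed

text \<open>The supports of finitely many generators lie in a finite set \<open>A\<close>, hence so
  do the supports of all elements. Applied to unit functions this places every standard exponent in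
  \<open>A\<close>; after that the standard exponents serve as coordinates.\<close>

lemma standard_monomials:
  assumes "vdim (quotient_space I) = enat d"
  shows "finite (- In)" "card (- In) = d"
proof -
  let ?W = "{h :: expo \<Rightarrow> 'k. finite {c. h c \<noteq> 0} \<and> (\<forall>c\<in>In. h c = 0)}"
  interpret M: function_model "quotient_space I" ?W "\<lambda>h. cls (Abs_poly_mapping h)"
    by (rule function_model_quotient)
  have "M.fin_dim" using assms by (simp add: vdim_def split: if_splits)
  then obtain F where F: "finite F" "F \<subseteq> ?W"
    "\<And>V. lin_subspace V \<Longrightarrow> F \<subseteq> V \<Longrightarrow> V \<subseteq> ?W \<Longrightarrow> ?W \<subseteq> V"
    using M.fin_dim_generators by blast
  define A where "A = (\<Union>h\<in>F. {c. h c \<noteq> 0})"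
  have "finite A" using F(1,2) by (auto simp: A_def)
  have "lin_subspace {h \<in> ?W. \<forall>c. c \<notin> A \<longrightarrow> h c = 0}"
    using M.W_closed by (auto simp: lin_subspace_def)
  then have W: "?W \<subseteq> {h \<in> ?W. \<forall>c. c \<notin> A \<longrightarrow> h c = 0}"
    using F(2) by (intro F(3)) (auto simp: A_def)
  have unit: "(\<lambda>x. if x = c then 1 else 0) \<in> ?W" if "c \<notin> In" for c
    using that by auto
  have "c \<in> A" if "c \<notin> In" for c
    using W unit[OF that] by (auto dest!: subsetD)
  then have sub: "- In \<subseteq> A" by blast
  then show fin: "finite (- In)" using \<open>finite A\<close> finite_subset by blast
  have "free_coords ?W (- In)"
  proof (rule free_coordsI[OF M.W fin])
    show "\<exists>u\<in>?W. \<forall>r\<in>- In. u r = (if r = c then 1 else 0)" if "c \<in> - In" for c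
      using unit[of c] that by (intro bexI[of _ "\<lambda>x. if x = c then 1 else 0"]) simp_all
    show "f = (\<lambda>_. 0)" if "f \<in> ?W" "\<And>q. q \<in> - In \<Longrightarrow> f q = 0" for f
      using that by (intro ext) (metis (mono_tags, lifting) ComplI mem_Collect_eq)
  qed
  then show "card (- In) = d" using M.vdim_eq_card assms by simp
qed

end

section \<open>Shifts by arbitrary monomials and the splitting by degree\<close>

context staircase begin

text \<open>Lowering an exponent of \<open>D\<close> never leads to \<open>E\<close>: it stays in
  \<open>D\<close> or leaves the octant, where functions in \<open>T S\<close> vanish. This
  alternative is the invariant that lets the shift relation be iterated.\<close>

lemma D_shift_down:
  assumes "c \<in> D \<or> (\<exists>k. coord k c < 0)"
  shows "shift i (- int t) c \<in> D \<or> (\<exists>k. coord k (shift i (- int t) c) < 0)"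
proof (cases "c \<in> D \<and> int t \<le> coord i c")
  case True
  then show ?thesis using D_down_iterate by blast
next
  case False
  then obtain k where "coord k c < 0 \<or> k = i \<and> coord i c < int t" using assms by fastforce
  then have "coord k (shift i (- int t) c) < 0" by (auto simp: coord_shift)
  then show ?thesis by blast
qed

lemma T_shift_iterate:
  assumes f: "f \<in> T S" and "b \<in> E" and "c \<in> D \<or> (\<exists>k. coord k c < 0)"
  shows "shift i (int t) b \<in> E \<and> f (shift i (int t) b, c) = f (b, shift i (- int t) c)"
  using assms(3)
proof (induction t arbitrary: c)
  case 0
  then show ?case using assms(2) by simp
next
  case (Suc t)
  have mem: "shift i (int t) b \<in> E" using Suc.IH[OF Suc.prems] by simp
  have up: "shift i (int (Suc t)) b = shift i 1 (shift i (int t) b)" by (simp add: algebra_simps)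
  have down: "shift i (- int (Suc t)) c = shift i (- int t) (shift i (-1) c)"
    by simp
  have "f (shift i (int (Suc t)) b, c) = f (shift i (int t) b, shift i (-1) c)"
  proof (cases "c \<in> D")
    case True
    then show ?thesis unfolding up by (rule T_shift[OF f mem])
  next
    case False
    then obtain k where "coord k c < 0" using Suc.prems by blast
    then have "coord k (shift i (-1) c) < 0" by (auto simp: coord_shift)
    then have "shift i (-1) c \<notin> D" using D_nonneg[of _ k] by (meson not_le)
    then show ?thesis using False T_support[OF f] by metis
  qed
  also have "\<dots> = f (b, shift i (- int (Suc t)) c)"
  proof -
    have "shift i (-1) c \<in> D \<or> (\<exists>k. coord k (shift i (-1) c) < 0)"
      using D_shift_down[OF Suc.prems, of i 1] by simp
    then show ?thesis unfolding down using Suc.IH by blast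
  qed
  finally have "f (shift i (int (Suc t)) b, c) = f (b, shift i (- int (Suc t)) c)" .
  moreover have "shift i (int (Suc t)) b \<in> E" unfolding up by (rule E_up[OF mem])
  ultimately show ?case by blast
qed

lemma T_shift_add:
  assumes f: "f \<in> T S" and b: "b \<in> E" and c: "c \<in> D"
  shows "f (deg3 a + b, c) = f (b, c - deg3 a)"
proof -
  obtain a1 a2 a3 where a: "a = (a1, a2, a3)" by (cases a)
  let ?P = "\<lambda>c. c \<in> D \<or> (\<exists>k. coord k c < 0)"
  have P: "?P (shift i (- int t) c)" if "?P c" for c i t
    using that by (rule D_shift_down)
  have "deg3 a + b = shift X3 (int a3) (shift X2 (int a2) (shift X1 (int a1) b))"
    by (cases b) (simp add: a deg3_def)
  moreover have "c - deg3 a = shift X1 (- int a1) (shift X2 (- int a2) (shift X3 (- int a3) c))"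
    by (cases c) (simp add: a deg3_def)
  ultimately show ?thesis
    using T_shift_iterate[OF f] P c b by metis
qed

text \<open>Each element is the sum of its homogeneous parts. The sum is finite because every degree
  with a nonzero value already occurs in the box, and there are finitely many differences between
  \<open>D\<close> and the box.\<close>

lemma T_span:
  assumes V: "lin_subspace V" and sub: "\<And>\<alpha>. \<alpha> \<in> S \<Longrightarrow> T {\<alpha>} \<subseteq> V"
  shows "(T S :: (_ \<Rightarrow> 'k::field) set) \<subseteq> V"
proof
  fix f :: "_ \<Rightarrow> 'k" assume f: "f \<in> T S"
  obtain B where B: "finite B" 
    "\<And>S (f :: _ \<Rightarrow> 'k) b c. f \<in> T S \<Longrightarrow> f (b, c) \<noteq> 0 \<Longrightarrow> \<exists>b'\<in>B. \<exists>c'\<in>D. f (b', c') \<noteq> 0 \<and> c' - b' = c - b"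
    using T_box by metis
  define A where "A = (\<lambda>(b, c). c - b) ` (B \<times> D) \<inter> S"
  define part where "part \<alpha> = (\<lambda>(b, c). if c - b = \<alpha> then f (b, c) else 0)" for \<alpha>
  have "finite A" using B(1) finite_D by (simp add: A_def)
  have "part \<alpha> \<in> T {\<alpha>}" for \<alpha>
    unfolding T_def part_def mem_Collect_eq
    using T_support[OF f] T_shift[OF f] by (auto split: if_splits)
  then have "part \<alpha> \<in> V" if "\<alpha> \<in> A" for \<alpha> using sub[of \<alpha>] that unfolding A_def by blast
  then have "(\<lambda>p. \<Sum>\<alpha>\<in>A. 1 * part \<alpha> p) \<in> V" by (rule lin_subspace_sum[OF V])
  moreover have "(\<lambda>p. \<Sum>\<alpha>\<in>A. 1 * part \<alpha> p) = f"
  proof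
    fix p :: "degree3 \<times> degree3"
    obtain b c where p: "p = (b, c)" by (cases p)
    have "c - b \<in> A" if "f (b, c) \<noteq> 0"
    proof -
      obtain b' c' where "b' \<in> B" "c' \<in> D" "c' - b' = c - b" using B(2)[OF f \<open>f (b, c) \<noteq> 0\<close>] by blast
      then have "c - b \<in> (\<lambda>(b, c). c - b) ` (B \<times> D)" by (intro image_eqI[of _ _ "(b', c')"]) auto
      then show ?thesis using T_support[OF f that] by (simp add: A_def)
    qed
    then show "(\<Sum>\<alpha>\<in>A. 1 * part \<alpha> p) = f p"
      using \<open>finite A\<close> by (auto simp: p part_def)
  qed
  ultimately show "f \<in> V" by simp
qed

end

lemma deg3_add: "deg3 (a + b) = deg3 a + deg3 b"
  by (cases a; cases b) (simp add: deg3_def)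

lemma inj_deg3: "inj deg3"
  by (auto simp: inj_def deg3_def)

lemma deg3_eq_iff [simp]: "deg3 a = deg3 b \<longleftrightarrow> a = b"
  using inj_deg3 by (auto dest: injD)

lemma coord_deg3: "0 \<le> coord i (deg3 a)"
  by (cases i; cases a) (auto simp: deg3_def)

lemma nonneg_deg3:
  assumes "\<And>i. 0 \<le> coord i a"
  obtains b where "a = deg3 b"
proof -
  obtain x y z where a: "a = (x, y, z)" by (cases a)
  have "a = deg3 (nat x, nat y, nat z)"
    using assms[of X1] assms[of X2] assms[of X3] by (simp add: a deg3_def)
  then show thesis by (rule that)
qed

fun axis_expo :: "axis \<Rightarrow> expo" where
  "axis_expo X1 = (1, 0, 0)" | "axis_expo X2 = (0, 1, 0)" | "axis_expo X3 = (0, 0, 1)"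

lemma deg3_axis: "deg3 (axis_expo i + b) = shift i 1 (deg3 b)"
  by (cases i; cases b) (auto simp: deg3_def)

section \<open>Homomorphisms as coefficient functions\<close>

locale finite_monomial_point = monomial_point I for I :: "'k::field poly3 set" +
  assumes finite_std: "finite (- In)"
begin

sublocale stair: staircase "deg3 ` (- In)"
proof
  show "finite (deg3 ` (- In))" using finite_std by simp
  show "0 \<le> coord i c" if "c \<in> deg3 ` (- In)" for c i using that coord_deg3 by auto
  fix c i assume "c \<in> deg3 ` (- In)" "1 \<le> coord i c"
  then obtain g where g: "g \<notin> In" "c = deg3 g" by auto
  have "0 \<le> coord j (shift i (-1) c)" for j
    using \<open>1 \<le> coord i c\<close> coord_deg3[of j g] g(2) by (simp add: coord_shift)
  then obtain g' where g': "shift i (-1) c = deg3 g'" using nonneg_deg3 by blast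
  have "deg3 (axis_expo i + g') = c" unfolding deg3_axis g'[symmetric] by simp
  then have "g = axis_expo i + g'" using g(2) by simp
  then have "g' \<notin> In" using g(1) In_up by blast
  then show "shift i (-1) c \<in> deg3 ` (- In)" using g' by simp
qed

lemma deg3_mem_std: "deg3 b \<in> deg3 ` (- In) \<longleftrightarrow> b \<notin> In"
  by auto

lemma deg3_mem_E: "deg3 b \<in> stair.E \<longleftrightarrow> b \<in> In"
  by (auto simp: stair.E_def coord_deg3)

lemma E_deg3: assumes "b \<in> stair.E" obtains a where "b = deg3 a" "a \<in> In"
proof -
  obtain a where "b = deg3 a" using nonneg_deg3 stair.E_nonneg[OF assms] by blast
  then show thesis using that assms deg3_mem_E by blast
qed

text \<open>Values are represented by combinations of standard monomials. The formula covers all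
  polynomials and not only \<open>I\<close>, so additivity is an exact equality without side
  conditions.\<close>

definition lift :: "(degree3 \<times> degree3 \<Rightarrow> 'k) \<Rightarrow> 'k poly3 \<Rightarrow> 'k poly3" where
  "lift f p = (\<Sum>c\<in>- In. Poly_Mapping.single c
     (\<Sum>b\<in>Poly_Mapping.keys p. Poly_Mapping.lookup p b * f (deg3 b, deg3 c)))"

lemma lookup_sum_single_std:
  "Poly_Mapping.lookup (\<Sum>c\<in>- In. Poly_Mapping.single c (h c)) g = (if g \<in> In then 0 else h g)"
proof -
  have "(\<Sum>c\<in>- In. Poly_Mapping.lookup (Poly_Mapping.single c (h c)) g) =
      (\<Sum>c\<in>- In. if g = c then h c else 0)"
    by (intro sum.cong) (auto simp: lookup_single)
  then show ?thesis using finite_std by (simp add: lookup_sum)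
qed

lemma lookup_lift:
  assumes "finite A" "Poly_Mapping.keys p \<subseteq> A"
  shows "Poly_Mapping.lookup (lift f p) c =
    (if c \<in> In then 0 else \<Sum>b\<in>A. Poly_Mapping.lookup p b * f (deg3 b, deg3 c))"
proof -
  have "(\<Sum>b\<in>Poly_Mapping.keys p. Poly_Mapping.lookup p b * f (deg3 b, deg3 c)) =
      (\<Sum>b\<in>A. Poly_Mapping.lookup p b * f (deg3 b, deg3 c))"
    using assms by (intro sum.mono_neutral_left) (auto simp: in_keys_iff)
  then show ?thesis by (simp add: lift_def lookup_sum_single_std)
qed

lemma lookup_lift_single:
  "Poly_Mapping.lookup (lift f (Poly_Mapping.single b l)) c =
    (if c \<in> In then 0 else l * f (deg3 b, deg3 c))"
  by (subst lookup_lift[of "{b}"]) auto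

lemma lift_add: "lift f (p + q) = lift f p + lift f q"
proof (rule poly_mapping_eqI)
  fix c
  let ?A = "Poly_Mapping.keys p \<union> Poly_Mapping.keys q"
  have A: "finite ?A" "Poly_Mapping.keys p \<subseteq> ?A" "Poly_Mapping.keys q \<subseteq> ?A"
    "Poly_Mapping.keys (p + q) \<subseteq> ?A"
    using Poly_Mapping.keys_add[of p q] by simp_all
  show "Poly_Mapping.lookup (lift f (p + q)) c = Poly_Mapping.lookup (lift f p + lift f q) c"
    by (simp add: lookup_add lookup_lift[OF A(1,2)] lookup_lift[OF A(1,3)] lookup_lift[OF A(1,4)]
        distrib_right sum.distrib)
qed

lemma lift_zero: "lift f 0 = 0"
  by (simp add: lift_def)

lemma lift_sum: "lift f (sum g A) = (\<Sum>a\<in>A. lift f (g a))"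
  by (induction A rule: infinite_finite_induct) (simp_all add: lift_zero lift_add)

lemma lift_add_fun: "lift (\<lambda>x. f x + g x) p = lift f p + lift g p"
  by (rule poly_mapping_eqI)
    (simp add: lookup_add lookup_lift[OF finite_keys subset_refl] distrib_left sum.distrib)

lemma lift_smult_fun: "lift (\<lambda>x. c * f x) p = const3 c * lift f p"
proof (rule poly_mapping_eqI)
  fix x
  show "Poly_Mapping.lookup (lift (\<lambda>x. c * f x) p) x = Poly_Mapping.lookup (const3 c * lift f p) x"
    using lookup_single_times_add[of 0 c "lift f p" x]
    by (simp add: const3_def lookup_lift[OF finite_keys subset_refl] sum_distrib_left mult.left_commute)
qed

lemma lift_zero_fun: "lift (\<lambda>_. 0) p = 0"
  by (simp add: lift_def)

text \<open>Equality holds modulo \<open>I\<close> only, since multiples of standard monomials may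
  fall into \<open>I\<close>. At a standard exponent \<open>g\<close> above \<open>a\<close> the
  shift relation identifies the coefficients; at any other, subtracting \<open>a\<close> leaves the
  octant and both coefficients are zero.\<close>

lemma lift_mult_single:
  assumes f: "f \<in> stair.T S" and b: "b \<in> In"
  shows "lift f (Poly_Mapping.single a k * Poly_Mapping.single b l)
    - Poly_Mapping.single a k * lift f (Poly_Mapping.single b l) \<in> I"
  unfolding mem_I_iff mult_single
proof
  fix g
  assume "g \<in> Poly_Mapping.keys (lift f (Poly_Mapping.single (a + b) (k * l))
    - Poly_Mapping.single a k * lift f (Poly_Mapping.single b l))"
  then have neq: "Poly_Mapping.lookup (lift f (Poly_Mapping.single (a + b) (k * l))) g \<noteq>
      Poly_Mapping.lookup (Poly_Mapping.single a k * lift f (Poly_Mapping.single b l)) g"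
    by (simp add: in_keys_iff lookup_minus)
  show "g \<in> In"
  proof (rule ccontr)
    assume g: "g \<notin> In"
    have shift: "f (deg3 (a + b), deg3 g) = f (deg3 b, deg3 g - deg3 a)"
      unfolding deg3_add using b g by (intro stair.T_shift_add[OF f]) (auto simp: deg3_mem_E)
    show False
    proof (cases "\<exists>c. g = a + c")
      case True
      then obtain c where c: "g = a + c" by blast
      then have "c \<notin> In" using g In_up by blast
      moreover have "deg3 g - deg3 a = deg3 c" by (simp add: c deg3_add)
      ultimately show False
        using neq shift g unfolding c lookup_single_times_add by (simp add: lookup_lift_single)
    next
      case False
      have "f (deg3 b, deg3 g - deg3 a) = 0"
      proof (rule ccontr)
        assume "f (deg3 b, deg3 g - deg3 a) \<noteq> 0"
        then have "deg3 g - deg3 a \<in> deg3 ` (- In)" using stair.T_support[OF f] by blast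
        then obtain c where "deg3 g - deg3 a = deg3 c" by blast
        then have "deg3 g = deg3 (a + c)" by (simp add: deg3_add algebra_simps)
        then show False using False by auto
      qed
      moreover have "Poly_Mapping.lookup (Poly_Mapping.single a k * lift f (Poly_Mapping.single b l)) g = 0"
        using False by (intro lookup_single_times_zero) blast
      ultimately show False using neq shift by (auto simp: lookup_lift_single split: if_splits)
    qed
  qed
qed

lemma lift_mult:
  assumes f: "f \<in> stair.T S" and p: "p \<in> I"
  shows "lift f (s * p) - s * lift f p \<in> I"
proof -
  let ?s = "\<lambda>a. Poly_Mapping.single a (Poly_Mapping.lookup s a)"
  let ?p = "\<lambda>b. Poly_Mapping.single b (Poly_Mapping.lookup p b)"
  have s: "s = (\<Sum>a\<in>Poly_Mapping.keys s. ?s a)" and p': "p = (\<Sum>b\<in>Poly_Mapping.keys p. ?p b)"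
    by (rule poly_mapping_sum_single; simp)+
  have "lift f (s * p) - s * lift f p =
      lift f ((\<Sum>a\<in>Poly_Mapping.keys s. ?s a) * (\<Sum>b\<in>Poly_Mapping.keys p. ?p b)) -
      (\<Sum>a\<in>Poly_Mapping.keys s. ?s a) * lift f (\<Sum>b\<in>Poly_Mapping.keys p. ?p b)"
    using s p' by simp
  also have "\<dots> = (\<Sum>a\<in>Poly_Mapping.keys s. \<Sum>b\<in>Poly_Mapping.keys p.
      lift f (?s a * ?p b) - ?s a * lift f (?p b))"
    by (simp add: sum_product lift_sum sum_subtractf)
  also have "\<dots> \<in> I"
    using p by (intro I_sum lift_mult_single[OF f]) (auto simp: mem_I_iff)
  finally show ?thesis .
qed

definition hom_of :: "(degree3 \<times> degree3 \<Rightarrow> 'k) \<Rightarrow> 'k poly3 \<Rightarrow> 'k poly3 set" where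
  "hom_of f = (\<lambda>p\<in>I. cls (lift f p))"

lemma cls_lift_monom_eq:
  assumes "cls (lift f (monom3 b)) = cls q" "c \<notin> In"
  shows "f (deg3 b, deg3 c) = Poly_Mapping.lookup q c"
proof -
  have "Poly_Mapping.keys (lift f (monom3 b) - q) \<subseteq> In"
    using assms(1) by (simp add: cls_eq_iff mem_I_iff)
  then have "Poly_Mapping.lookup (lift f (monom3 b) - q) c = 0"
    using assms(2) by (auto simp: in_keys_iff)
  then show ?thesis using assms(2) by (simp add: lookup_minus monom3_def lookup_lift_single)
qed

lemma tangent_simps:
  "carrier (tangent_space I) = module_hom poly_ring (ideal_module I) (quotient_module I) \<inter> extensional I"
  "zero (tangent_space I) = (\<lambda>f\<in>I. \<zero>\<^bsub>quotient_module I\<^esub>)"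
  "add (tangent_space I) = (\<lambda>\<phi> \<psi>. \<lambda>f\<in>I. \<phi> f \<oplus>\<^bsub>quotient_module I\<^esub> \<psi> f)"
  "Module.module.smult (tangent_space I) = (\<lambda>c \<phi>. \<lambda>f\<in>I. const3 c \<odot>\<^bsub>quotient_module I\<^esub> \<phi> f)"
  by (simp_all add: restrict_scalars_def tangent_module_def)

lemma module_hom_iff:
  "\<phi> \<in> module_hom poly_ring (ideal_module I) (quotient_module I) \<longleftrightarrow>
    (\<forall>p\<in>I. \<phi> p \<in> range cls) \<and> (\<forall>p\<in>I. \<forall>q\<in>I. \<phi> (p + q) = \<phi> p \<oplus>\<^bsub>quotient_module I\<^esub> \<phi> q) \<and>
    (\<forall>s. \<forall>p\<in>I. \<phi> (s * p) = s \<odot>\<^bsub>quotient_module I\<^esub> \<phi> p)"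
  by (auto simp: module_hom_def ideal_module_def carrier_quotient_module Pi_iff)

lemma hom_of_mem:
  assumes "f \<in> stair.T S"
  shows "hom_of f \<in> carrier (tangent_space I)"
  using lift_mult[OF assms]
  by (auto simp: tangent_simps module_hom_iff hom_of_def I_add I_mult add_quotient_module
      smult_quotient_module lift_add cls_eq_iff)

lemma T_eqI:
  assumes f: "f \<in> stair.T S" and g: "g \<in> stair.T S'"
    and eq: "\<And>b c. b \<in> In \<Longrightarrow> c \<notin> In \<Longrightarrow> f (deg3 b, deg3 c) = g (deg3 b, deg3 c)"
  shows "f = g"
proof
  fix p :: "degree3 \<times> degree3"
  obtain b c where p: "p = (b, c)" by (cases p)
  show "f p = g p"
  proof (cases "b \<in> stair.E \<and> c \<in> deg3 ` (- In)")
    case True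
    then obtain b' c' where "b = deg3 b'" "b' \<in> In" "c = deg3 c'" "c' \<notin> In"
      using E_deg3 by (metis ComplD imageE)
    then show ?thesis using eq by (simp add: p)
  next
    case False
    then show ?thesis using stair.T_support[OF f] stair.T_support[OF g] unfolding p by metis
  qed
qed

lemma hom_of_inj:
  assumes "f \<in> stair.T S" "g \<in> stair.T S'" "hom_of f = hom_of g"
  shows "f = g"
  using assms(1,2)
proof (rule T_eqI)
  fix b c assume b: "b \<in> In" and c: "c \<notin> In"
  have eq: "cls (lift f (monom3 b)) = cls (lift g (monom3 b))"
    using fun_cong[OF assms(3), of "monom3 b"] b by (simp add: hom_of_def In_def)
  then show "f (deg3 b, deg3 c) = g (deg3 b, deg3 c)"
    using cls_lift_monom_eq[OF eq c] c by (simp add: monom3_def lookup_lift_single)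
qed

text \<open>The representatives \<open>r\<close> may be arbitrary, because congruent polynomials
  agree at standard exponents. Linearity with respect to the three variables gives the shift
  relations, and agreement on monomials spreads to \<open>I\<close> by linearity.\<close>

lemma hom_of_surj:
  assumes \<phi>: "\<phi> \<in> carrier (tangent_space I)"
  obtains f where "f \<in> stair.T UNIV" "\<phi> = hom_of f"
proof -
  have range: "\<And>p. p \<in> I \<Longrightarrow> \<phi> p \<in> range cls"
    and add: "\<And>p q. p \<in> I \<Longrightarrow> q \<in> I \<Longrightarrow> \<phi> (p + q) = \<phi> p \<oplus>\<^bsub>quotient_module I\<^esub> \<phi> q"
    and smult: "\<And>s p. p \<in> I \<Longrightarrow> \<phi> (s * p) = s \<odot>\<^bsub>quotient_module I\<^esub> \<phi> p"
    and ext: "\<phi> \<in> extensional I"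
    using \<phi> by (auto simp: tangent_simps module_hom_iff)
  have "\<forall>b. \<exists>q. b \<in> In \<longrightarrow> \<phi> (monom3 b) = cls q" using range by (auto simp: In_def)
  then obtain r where r: "\<And>b. b \<in> In \<Longrightarrow> \<phi> (monom3 b) = cls (r b)" by metis
  define f where "f = (\<lambda>(x, y). if x \<in> stair.E \<and> y \<in> deg3 ` (- In)
    then Poly_Mapping.lookup (r (inv_into UNIV deg3 x)) (inv_into UNIV deg3 y) else 0)"
  have f_deg3: "f (deg3 b, deg3 c) = Poly_Mapping.lookup (r b) c" if "b \<in> In" "c \<notin> In" for b c
    using that by (simp add: f_def deg3_mem_E deg3_mem_std inv_f_f[OF inj_deg3])
  have "f \<in> stair.T UNIV"
    unfolding stair.T_def mem_Collect_eq
  proof (intro conjI allI ballI impI)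
    fix i b c assume "b \<in> stair.E" "c \<in> deg3 ` (- In)"
    then obtain \<beta> \<gamma> where bc: "b = deg3 \<beta>" "\<beta> \<in> In" "c = deg3 \<gamma>" "\<gamma> \<notin> In"
      using E_deg3 by (metis ComplD imageE)
    let ?a = "axis_expo i"
    have a\<beta>: "?a + \<beta> \<in> In" using bc(2) by (rule In_up)
    have "cls (r (?a + \<beta>)) = \<phi> (monom3 ?a * monom3 \<beta>)"
      using r[OF a\<beta>] by (simp add: monom3_def mult_single)
    also have "\<dots> = cls (monom3 ?a * r \<beta>)"
      using bc(2) r[OF bc(2)] smult by (simp add: In_def smult_quotient_module)
    finally have "Poly_Mapping.keys (r (?a + \<beta>) - monom3 ?a * r \<beta>) \<subseteq> In"
      by (simp add: cls_eq_iff mem_I_iff)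
    then have "Poly_Mapping.lookup (r (?a + \<beta>) - monom3 ?a * r \<beta>) \<gamma> = 0"
      using bc(4) by (auto simp: in_keys_iff)
    then have eq: "f (shift i 1 b, c) = Poly_Mapping.lookup (Poly_Mapping.single ?a 1 * r \<beta>) \<gamma>"
      unfolding bc(1,3) deg3_axis[symmetric] f_deg3[OF a\<beta> bc(4)] by (simp add: lookup_minus monom3_def)
    show "f (shift i 1 b, c) = f (b, shift i (-1) c)"
    \<comment> \<open>If the variable does not divide the monomial, lowering the exponent leaves the
      octant, where \<open>f\<close> has its default value 0; the product has no such coefficient
      either.\<close>
    proof (cases "\<exists>\<gamma>'. \<gamma> = ?a + \<gamma>'")
      case True
      then obtain \<gamma>' where \<gamma>': "\<gamma> = ?a + \<gamma>'" by blast
      then have "\<gamma>' \<notin> In" using bc(4) In_up by blast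
      moreover have "shift i (-1) c = deg3 \<gamma>'" unfolding bc(3) \<gamma>' deg3_axis by simp
      ultimately show ?thesis
        unfolding eq \<gamma>' lookup_single_times_add by (simp add: bc f_deg3)
    next
      case False
      have "shift i (-1) c \<notin> deg3 ` (- In)"
      proof
        assume "shift i (-1) c \<in> deg3 ` (- In)"
        then obtain \<gamma>' where "shift i (-1) c = deg3 \<gamma>'" by blast
        then have "deg3 (?a + \<gamma>') = c" unfolding deg3_axis by (metis add.left_inverse shift_0 shift_shift)
        then show False using False bc(3) by auto
      qed
      then show ?thesis
        unfolding eq using False by (subst lookup_single_times_zero) (auto simp: f_def)
    qed
  qed (auto simp: f_def split: if_splits)
  note f = this
  have monom: "\<phi> (monom3 b) = cls (lift f (monom3 b))" if "b \<in> In" for b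
  proof -
    have "r b - lift f (monom3 b) \<in> I"
      unfolding mem_I_iff using that
      by (auto simp: in_keys_iff lookup_minus monom3_def lookup_lift_single f_deg3 simp del: split_paired_all split: if_splits)
    then show ?thesis by (simp add: r[OF that] cls_eq_iff)
  qed
  have single: "\<phi> (Poly_Mapping.single b k) = cls (lift f (Poly_Mapping.single b k))" if "b \<in> In" for b k
  proof -
    have b: "monom3 b \<in> I" using that by (simp add: In_def)
    have "\<phi> (Poly_Mapping.single b k) = cls (const3 k * lift f (monom3 b))"
      unfolding single_eq_monom3 smult[OF b] monom[OF that] smult_quotient_module ..
    also have "\<dots> = cls (lift f (const3 k * monom3 b))"
      using lift_mult[OF f b] by (metis cls_eq_iff)
    finally show ?thesis by (simp add: single_eq_monom3)
  qed
  \<comment> \<open>The induction runs over terms with exponents in \<open>In\<close>, so that every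
    partial sum stays in \<open>I\<close> and the additivity of \<phi> applies.\<close>
  have sum: "\<phi> (\<Sum>b\<in>A. Poly_Mapping.single b (h b)) = cls (lift f (\<Sum>b\<in>A. Poly_Mapping.single b (h b)))"
    if "finite A" "A \<subseteq> In" for A h
    using that
  proof (induction A rule: finite_induct)
    case empty
    obtain q where "\<phi> 0 = cls q" using range[OF I_zero] by blast
    then show ?case using smult[OF I_zero, of 0] by (simp add: smult_quotient_module lift_zero)
  next
    case (insert b A)
    have mem: "Poly_Mapping.single c (h c) \<in> I" if "c \<in> insert b A" for c
      using insert.prems that by (auto simp: mem_I_iff)
    then have "(\<Sum>b\<in>A. Poly_Mapping.single b (h b)) \<in> I" by (intro I_sum) simp
    moreover have "Poly_Mapping.single b (h b) \<in> I" by (intro mem) simp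
    ultimately show ?case using insert by (simp add: add single add_quotient_module lift_add)
  qed
  have "\<phi> = hom_of f"
  proof (rule extensionalityI[OF ext])
    show "hom_of f \<in> extensional I" by (simp add: hom_of_def)
    fix p assume p: "p \<in> I"
    have "p = (\<Sum>b\<in>Poly_Mapping.keys p. Poly_Mapping.single b (Poly_Mapping.lookup p b))"
      by (rule poly_mapping_sum_single) simp_all
    then show "\<phi> p = hom_of f p"
      using sum[of "Poly_Mapping.keys p" "Poly_Mapping.lookup p"] p by (simp add: hom_of_def mem_I_iff)
  qed
  with f show thesis by (rule that)
qed

lemma function_model_tangent: "function_model (tangent_space I) (stair.T UNIV) hom_of"
proof
  show "lin_subspace (stair.T UNIV :: (_ \<Rightarrow> 'k) set)" by (rule stair.lin_subspace_T)
  show "carrier (tangent_space I) = hom_of ` stair.T UNIV"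
  proof (intro equalityI subsetI)
    fix \<phi> assume "\<phi> \<in> carrier (tangent_space I)"
    then show "\<phi> \<in> hom_of ` stair.T UNIV" by (elim hom_of_surj) (rule image_eqI)
  qed (auto intro: hom_of_mem)
  show "inj_on hom_of (stair.T UNIV)" using hom_of_inj by (rule inj_onI)
qed (auto simp: tangent_simps hom_of_def lift_zero_fun lift_add_fun lift_smult_fun
    zero_quotient_module add_quotient_module smult_quotient_module fun_eq_iff)

text \<open>A homogeneous representative may differ from \<open>lift\<close> by an element of
  \<open>I\<close>, but both have the same coefficients at standard exponents, and these carry the
  degree. Conversely, \<open>lift\<close> itself is homogeneous.\<close>

lemma hom_of_component:
  assumes f: "f \<in> stair.T UNIV"
  shows "hom_of f \<in> tangent_component I \<alpha> \<longleftrightarrow> f \<in> stair.T {\<alpha>}"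
proof
  assume "hom_of f \<in> tangent_component I \<alpha>"
  then have comp: "cls (lift f (monom3 \<beta>)) \<in> quotient_component I (\<alpha> + deg3 \<beta>)" if "\<beta> \<in> In" for \<beta>
    using that by (auto simp: tangent_component_def In_def hom_of_def)
  have "c - b = \<alpha>" if nz: "f (b, c) \<noteq> 0" for b c
  proof -
    obtain \<beta> \<gamma> where bc: "b = deg3 \<beta>" "\<beta> \<in> In" "c = deg3 \<gamma>" "\<gamma> \<notin> In"
      using stair.T_support[OF f nz] E_deg3 by (metis ComplD imageE)
    obtain p where p: "cls (lift f (monom3 \<beta>)) = cls p" "\<forall>\<gamma>\<in>Poly_Mapping.keys p. deg3 \<gamma> = \<alpha> + deg3 \<beta>"
      using comp[OF bc(2)] by (auto simp: quotient_component_def)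
    have "\<gamma> \<in> Poly_Mapping.keys p"
      using cls_lift_monom_eq[OF p(1) bc(4)] nz by (simp add: bc in_keys_iff)
    then show ?thesis using p(2) by (simp add: bc)
  qed
  then show "f \<in> stair.T {\<alpha>}" using f by (simp add: stair.T_def)
next
  assume f': "f \<in> stair.T {\<alpha>}"
  have "cls (lift f (monom3 \<beta>)) \<in> quotient_component I (\<alpha> + deg3 \<beta>)" for \<beta>
    unfolding quotient_component_def
  proof (intro imageI CollectI ballI)
    fix \<gamma> assume "\<gamma> \<in> Poly_Mapping.keys (lift f (monom3 \<beta>))"
    then have "f (deg3 \<beta>, deg3 \<gamma>) \<noteq> 0"
      by (auto simp: in_keys_iff monom3_def lookup_lift_single split: if_splits)
    then have "deg3 \<gamma> - deg3 \<beta> = \<alpha>" using stair.T_support[OF f'] by blast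
    then show "deg3 \<gamma> = \<alpha> + deg3 \<beta>" by (metis diff_add_cancel)
  qed
  then show "hom_of f \<in> tangent_component I \<alpha>"
    using hom_of_mem[OF f] by (simp add: tangent_component_def hom_of_def)
qed

lemma tangent_component_eq: "tangent_component I \<alpha> = hom_of ` stair.T {\<alpha>}"
proof -
  have "stair.T {\<alpha>} \<subseteq> (stair.T UNIV :: (_ \<Rightarrow> 'k) set)" by (auto simp: stair.T_def)
  moreover have "tangent_component I \<alpha> \<subseteq> carrier (tangent_space I)"
    by (auto simp: tangent_component_def)
  moreover have "carrier (tangent_space I) = hom_of ` stair.T UNIV"
    by (rule function_model.carrier[OF function_model_tangent])
  ultimately show ?thesis using hom_of_component by fast
qed

text \<open>Transported through \<open>hom_of\<close>, the span is generated by the spaces of single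
  degrees, and the splitting into homogeneous parts shows that it is the whole space of the
  signature.\<close>

lemma function_model_signed:
  "function_model (tangent_signed s I) (stair.T {\<alpha>. has_signature s \<alpha>}) hom_of"
proof -
  let ?S = "{\<alpha>. has_signature s \<alpha>}"
  let ?T = "stair.T :: _ \<Rightarrow> (_ \<Rightarrow> 'k) set"
  interpret M: function_model "tangent_space I" "?T UNIV" hom_of
    by (rule function_model_tangent)
  have mono: "?T A \<subseteq> ?T B" if "A \<subseteq> B" for A B using that by (auto simp: stair.T_def)
  have "M.span (hom_of ` (\<Union>\<alpha>\<in>?S. ?T {\<alpha>})) = hom_of ` ?T ?S"
  proof (rule M.span_image)
    show "(\<Union>\<alpha>\<in>?S. ?T {\<alpha>}) \<subseteq> ?T ?S" by (intro UN_least mono) simp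
    show "?T ?S \<subseteq> V" if "lin_subspace V" "(\<Union>\<alpha>\<in>?S. ?T {\<alpha>}) \<subseteq> V" for V
    proof (rule stair.T_span[OF that(1)])
      show "?T {\<alpha>} \<subseteq> V" if "\<alpha> \<in> ?S" for \<alpha>
        using that \<open>(\<Union>\<alpha>\<in>?S. ?T {\<alpha>}) \<subseteq> V\<close> by (simp add: UN_subset_iff)
    qed
  qed (simp_all add: stair.lin_subspace_T mono)
  then have carrier: "carrier (tangent_signed s I) = hom_of ` ?T ?S"
    by (simp add: tangent_signed_def tangent_component_eq image_UN)
  have U: "f \<in> ?T UNIV" if "f \<in> ?T ?S" for f using that mono[of ?S UNIV] by blast
  show ?thesis
  proof
    show "carrier (tangent_signed s I) = hom_of ` ?T ?S" by (rule carrier)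
    show "inj_on hom_of (?T ?S)" by (rule inj_on_subset[OF M.inj]) (rule mono, simp)
  qed (simp_all add: stair.lin_subspace_T tangent_signed_def M.zero M.add M.smult U)
qed

lemma vdim_signed:
  assumes s: "s \<in> {(letter_p, letter_p, letter_n), (letter_p, letter_n, letter_p), (letter_n, letter_p, letter_p)}"
    and s': "{\<alpha>. has_signature s' \<alpha>} = dual_degrees {\<alpha>. has_signature s \<alpha>}"
  shows "vdim (tangent_signed s I) = vdim (tangent_signed s' I) + enat (card (- In))"
proof -
  obtain Q where Q: "free_coords (stair.T {\<alpha>. has_signature s \<alpha>} :: (_ \<Rightarrow> 'k) set) Q"
    "Q \<subseteq> stair.E \<times> deg3 ` (- In)"
    by (rule stair.T_coords)
  obtain Q' where Q': "free_coords (stair.T {\<alpha>. has_signature s' \<alpha>} :: (_ \<Rightarrow> 'k) set) Q'"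
    "Q' \<subseteq> stair.E \<times> deg3 ` (- In)"
    by (rule stair.T_coords)
  have "card Q = card Q' + card (deg3 ` (- In))"
    using Q' unfolding s' by (rule stair.card_T_coords[OF s refl Q])
  moreover have "card (deg3 ` (- In)) = card (- In)"
    using inj_deg3 by (intro card_image) (auto intro: inj_on_subset)
  ultimately show ?thesis
    using function_model.vdim_eq_card[OF function_model_signed Q(1)]
      function_model.vdim_eq_card[OF function_model_signed Q'(1)] by simp
qed

end

theorem theorem2p4:
  fixes I :: "'k::field poly3 set" and d :: nat
  assumes "infinite (UNIV :: 'k set)"
    and "monomial_ideal I"
    and "vdim (quotient_space I) = enat d"
  shows "vdim (tangent_signed (letter_p, letter_p, letter_n) I) =
           vdim (tangent_signed (letter_n, letter_n, letter_p) I) + enat d \<and>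
         vdim (tangent_signed (letter_p, letter_n, letter_p) I) =
           vdim (tangent_signed (letter_n, letter_p, letter_n) I) + enat d \<and>
         vdim (tangent_signed (letter_n, letter_p, letter_p) I) =
           vdim (tangent_signed (letter_p, letter_n, letter_n) I) + enat d"
proof -
  interpret monomial_point I by unfold_locales (rule assms(2))
  interpret finite_monomial_point I by unfold_locales (rule standard_monomials(1)[OF assms(3)])
  have dual: "{\<alpha>. has_signature (letter_n, letter_n, letter_p) \<alpha>} =
      dual_degrees {\<alpha>. has_signature (letter_p, letter_p, letter_n) \<alpha>}"
    "{\<alpha>. has_signature (letter_n, letter_p, letter_n) \<alpha>} =
      dual_degrees {\<alpha>. has_signature (letter_p, letter_n, letter_p) \<alpha>}"
    "{\<alpha>. has_signature (letter_p, letter_n, letter_n) \<alpha>} =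
      dual_degrees {\<alpha>. has_signature (letter_n, letter_p, letter_p) \<alpha>}"
    by (auto simp: dual_degrees_def)
  show ?thesis
    using vdim_signed[OF _ dual(1)] vdim_signed[OF _ dual(2)] vdim_signed[OF _ dual(3)]
    by (simp add: standard_monomials(2)[OF assms(3)])
qed

end
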